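(* Let $(X,\omega_X)$ and $(Y,\omega_Y)$ be smooth affine complex varieties equipped with algebraic symplectic forms. Let $p_X\colon X\times Y\to X$ and $p_Y\colon X\times Y\to Y$ be the projections and equip $X\times Y$ with the symplectic form $\omega_{X\times Y}=p_X^*\omega_X+p_Y^*\omega_Y$. If $(X,\omega_X)$ and $(Y,\omega_Y)$ have the algebraic Hamiltonian density property, then $(X\times Y,\omega_{X\times Y})$ has the algebraic Hamiltonian density property.
   Context: An algebraic (resp. holomorphic) symplectic form is a closed, nowhere degenerate algebraic (resp. holomorphic) $(2,0)$-form. A vector field $V$ on $(X,\omega)$ is Hamiltonian if $i_V\omega=df$ for some function $f$ on $X$ (regular in the algebraic setting, holomorphic in the holomorphic setting), called the Hamiltonian function of $V$. A vector field is complete if its flow exists for all complex times from every initial point. For a smooth affine complex variety $X$ with an algebraic symplectic form $\omega$, $\mathrm{HVF}^{\mathrm{alg}}_\omega(X)$ denotes the Lie algebra (under the commutator of vector fields) of algebraic Hamiltonian vector fields. $(X,\omega)$ has the algebraic Hamiltonian density property if the Lie algebra generated by the complete algebraic Hamiltonian vector fields on $X$ equals $\mathrm{HVF}^{\mathrm{alg}}_\omega(X)$. *)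

theory Defs
  imports "HOL-Analysis.Analysis"
begin

section \<open>Affine varieties in complex affine space\<close>

text \<open>An affine variety is given by a closed embedding into \<open>\<complex>\<^sup>n = complex ^ 'n\<close>.  Over the infinite field
  of complex numbers, polynomials are identified with polynomial functions.\<close>

inductive poly_fun :: "(complex ^ 'n \<Rightarrow> complex) \<Rightarrow> bool" where
  const: "poly_fun (\<lambda>_. c)"
| coord: "poly_fun (\<lambda>p. p $ i)"
| add: "poly_fun F \<Longrightarrow> poly_fun G \<Longrightarrow> poly_fun (\<lambda>p. F p + G p)"
| mult: "poly_fun F \<Longrightarrow> poly_fun G \<Longrightarrow> poly_fun (\<lambda>p. F p * G p)"

definition algebraic_set :: "(complex ^ 'n) set \<Rightarrow> bool" where
  "algebraic_set X \<longleftrightarrow> (\<exists>S. (\<forall>F\<in>S. poly_fun F) \<and> X = {p. \<forall>F\<in>S. F p = 0})"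

definition vanishing_ideal :: "(complex ^ 'n) set \<Rightarrow> (complex ^ 'n \<Rightarrow> complex) set" where
  "vanishing_ideal X = {F. poly_fun F \<and> (\<forall>p\<in>X. F p = 0)}"

text \<open>\<^const>\<open>frechet_derivative\<close> is the real derivative; for a polynomial function it is
  complex linear and given by the formal partial derivatives.\<close>

definition tangent_space :: "(complex ^ 'n) set \<Rightarrow> complex ^ 'n \<Rightarrow> (complex ^ 'n) set" where
  "tangent_space X p = {v. \<forall>F\<in>vanishing_ideal X. frechet_derivative F (at p) v = 0}"

text \<open>Smoothness is the Jacobian condition: on a principal Zariski neighbourhood \<open>h \<noteq> 0\<close> of \<open>p\<close>, the ideal
  of \<open>X\<close> is generated (in the localisation at \<open>h\<close>) by finitely many elements whose differentials
  are linearly independent at \<open>p\<close>.  Irreducibility is not required, and components may have different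
  dimensions.\<close>

definition smooth_at :: "(complex ^ 'n) set \<Rightarrow> complex ^ 'n \<Rightarrow> bool" where
  "smooth_at X p \<longleftrightarrow>
    (\<exists>(r::nat) f h.
      (\<forall>k<r. f k \<in> vanishing_ideal X) \<and> poly_fun h \<and> h p \<noteq> 0 \<and>
      (\<forall>G\<in>vanishing_ideal X. \<exists>N a. (\<forall>k<r. poly_fun (a k)) \<and>
          (\<forall>q. h q ^ N * G q = (\<Sum>k<r. a k q * f k q))) \<and>
      (\<forall>c. (\<forall>v. (\<Sum>k<r. c k * frechet_derivative (f k) (at p) v) = 0) \<longrightarrow> (\<forall>k<r. c k = 0)))"

definition smooth_affine_variety :: "(complex ^ 'n) set \<Rightarrow> bool" where
  "smooth_affine_variety X \<longleftrightarrow> algebraic_set X \<and> (\<forall>p\<in>X. smooth_at X p)"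


section \<open>Regular functions, vector fields and forms\<close>

definition regular_fun :: "(complex ^ 'n) set \<Rightarrow> (complex ^ 'n \<Rightarrow> complex) \<Rightarrow> bool" where
  "regular_fun X f \<longleftrightarrow> (\<exists>F. poly_fun F \<and> (\<forall>p\<in>X. f p = F p))"

text \<open>The differential of a regular function on \<open>X\<close>, computed from a polynomial extension.  It is
  meaningful for \<open>p \<in> X\<close> and \<open>v\<close> tangent to \<open>X\<close> at \<open>p\<close>, where it does not depend on the extension
  (lemma \<open>differential_eq\<close> below).\<close>

definition differential ::
    "(complex ^ 'n) set \<Rightarrow> (complex ^ 'n \<Rightarrow> complex) \<Rightarrow> complex ^ 'n \<Rightarrow> complex ^ 'n \<Rightarrow> complex" where
  "differential X f p v =
    frechet_derivative (SOME F. poly_fun F \<and> (\<forall>q\<in>X. f q = F q)) (at p) v"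

lemma poly_fun_differentiable: "poly_fun F \<Longrightarrow> F differentiable (at p)"
proof (induction rule: poly_fun.induct)
  case (coord i)
  then show ?case
    by (intro bounded_linear_imp_differentiable bounded_linear_vec_nth)
qed auto

lemma differential_eq:
  assumes F: "poly_fun F" "\<forall>q\<in>X. f q = F q" and v: "v \<in> tangent_space X p"
  shows "differential X f p v = frechet_derivative F (at p) v"
proof -
  define G where "G = (SOME F. poly_fun F \<and> (\<forall>q\<in>X. f q = F q))"
  have G: "poly_fun G \<and> (\<forall>q\<in>X. f q = G q)"
    unfolding G_def by (rule someI[of _ F]) (use F in simp)
  let ?H = "\<lambda>q. G q + (-1) * F q"
  have "poly_fun ?H"
    using G F by (intro poly_fun.intros) auto
  then have "?H \<in> vanishing_ideal X"
    using G F by (auto simp: vanishing_ideal_def)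
  then have 0: "frechet_derivative ?H (at p) v = 0"
    using v by (auto simp: tangent_space_def)
  have "(G has_derivative frechet_derivative G (at p)) (at p)"
    "(F has_derivative frechet_derivative F (at p)) (at p)"
    using G F poly_fun_differentiable frechet_derivative_works by blast+
  then have "(?H has_derivative
      (\<lambda>v. frechet_derivative G (at p) v + (-1) * frechet_derivative F (at p) v)) (at p)"
    by (intro derivative_intros)
  from frechet_derivative_at[OF this] 0 show ?thesis
    unfolding differential_def G_def[symmetric] by (metis (no_types, lifting) add.right_inverse
        add_right_imp_eq mult_minus1 add_eq_0_iff minus_minus)
qed

text \<open>Vector fields on \<open>X\<close> are extended by zero outside \<open>X\<close>, so that two vector fields on \<open>X\<close> agree
  precisely when they are equal as functions.\<close>

definition algebraic_vector_field :: "(complex ^ 'n) set \<Rightarrow> (complex ^ 'n \<Rightarrow> complex ^ 'n) \<Rightarrow> bool" where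
  "algebraic_vector_field X V \<longleftrightarrow>
    (\<forall>i. regular_fun X (\<lambda>p. V p $ i)) \<and>
    (\<forall>p\<in>X. V p \<in> tangent_space X p) \<and> (\<forall>p. p \<notin> X \<longrightarrow> V p = 0)"

text \<open>The commutator: its \<open>i\<close>-th component is \<open>V(W\<^sub>i) - W(V\<^sub>i)\<close>.\<close>

definition commutator ::
    "(complex ^ 'n) set \<Rightarrow> (complex ^ 'n \<Rightarrow> complex ^ 'n) \<Rightarrow> (complex ^ 'n \<Rightarrow> complex ^ 'n) \<Rightarrow>
      complex ^ 'n \<Rightarrow> complex ^ 'n" where
  "commutator X V W = (\<lambda>p. if p \<in> X
    then (\<chi> i. differential X (\<lambda>q. W q $ i) p (V p) - differential X (\<lambda>q. V q $ i) p (W p))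
    else 0)"

inductive_set lie_generated ::
    "(complex ^ 'n) set \<Rightarrow> (complex ^ 'n \<Rightarrow> complex ^ 'n) set \<Rightarrow> (complex ^ 'n \<Rightarrow> complex ^ 'n) set"
  for X S where
  gen: "V \<in> S \<Longrightarrow> V \<in> lie_generated X S"
| zero: "(\<lambda>_. 0) \<in> lie_generated X S"
| add: "V \<in> lie_generated X S \<Longrightarrow> W \<in> lie_generated X S \<Longrightarrow> (\<lambda>p. V p + W p) \<in> lie_generated X S"
| scale: "V \<in> lie_generated X S \<Longrightarrow> (\<lambda>p. c *s V p) \<in> lie_generated X S"
| commutator: "V \<in> lie_generated X S \<Longrightarrow> W \<in> lie_generated X S \<Longrightarrow>
    commutator X V W \<in> lie_generated X S"

text \<open>The flow of \<open>V\<close> through every point of \<open>X\<close> is defined for all complex times.\<close>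

definition complete_vector_field :: "(complex ^ 'n) set \<Rightarrow> (complex ^ 'n \<Rightarrow> complex ^ 'n) \<Rightarrow> bool" where
  "complete_vector_field X V \<longleftrightarrow>
    (\<forall>p\<in>X. \<exists>\<gamma>. \<gamma> 0 = p \<and> (\<forall>t::complex. \<gamma> t \<in> X) \<and>
      (\<forall>t i. ((\<lambda>s. \<gamma> s $ i) has_field_derivative V (\<gamma> t) $ i) (at t)))"

text \<open>A \<open>2\<close>-form \<open>\<omega>\<close> on \<open>X\<close> is a family of forms \<open>\<omega> p v w\<close>; only its values for \<open>p \<in> X\<close> and \<open>v\<close>, \<open>w\<close>
  tangent to \<open>X\<close> at \<open>p\<close> matter.  Since \<open>X\<close> is closed in \<open>\<complex>\<^sup>n\<close>, algebraic \<open>2\<close>-forms are exactly the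
  restrictions of \<open>(1/2) \<Sum> A\<^sub>i\<^sub>j dx\<^sub>i \<and> dx\<^sub>j\<close> with a skew-symmetric matrix \<open>A\<close> of polynomials.\<close>

definition form_coefficients ::
    "(complex ^ 'n) set \<Rightarrow> (complex ^ 'n \<Rightarrow> complex ^ 'n \<Rightarrow> complex ^ 'n \<Rightarrow> complex) \<Rightarrow>
      ('n \<Rightarrow> 'n \<Rightarrow> complex ^ 'n \<Rightarrow> complex) \<Rightarrow> bool" where
  "form_coefficients X \<omega> A \<longleftrightarrow>
    (\<forall>i j. poly_fun (A i j)) \<and> (\<forall>i j p. A i j p = - A j i p) \<and>
    (\<forall>p\<in>X. \<forall>v\<in>tangent_space X p. \<forall>w\<in>tangent_space X p.
      \<omega> p v w = (\<Sum>i\<in>UNIV. \<Sum>j\<in>UNIV. A i j p * v $ i * w $ j))"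

text \<open>The exterior derivative of \<open>(1/2) \<Sum> A\<^sub>i\<^sub>j dx\<^sub>i \<and> dx\<^sub>j\<close>, evaluated on three vectors.\<close>

definition exterior_deriv ::
    "('n::finite \<Rightarrow> 'n \<Rightarrow> complex ^ 'n \<Rightarrow> complex) \<Rightarrow>
      complex ^ 'n \<Rightarrow> complex ^ 'n \<Rightarrow> complex ^ 'n \<Rightarrow> complex ^ 'n \<Rightarrow> complex" where
  "exterior_deriv A p u v w = (\<Sum>i\<in>UNIV. \<Sum>j\<in>UNIV.
      frechet_derivative (A i j) (at p) u * v $ i * w $ j +
      frechet_derivative (A i j) (at p) v * w $ i * u $ j +
      frechet_derivative (A i j) (at p) w * u $ i * v $ j)"

text \<open>On a smooth \<open>X\<close>, the restriction of the exterior derivative to \<open>X\<close> does not depend on the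
  coefficients \<open>A\<close> chosen to represent \<open>\<omega>\<close>.\<close>

definition closed_algebraic_form ::
    "(complex ^ 'n) set \<Rightarrow> (complex ^ 'n \<Rightarrow> complex ^ 'n \<Rightarrow> complex ^ 'n \<Rightarrow> complex) \<Rightarrow> bool" where
  "closed_algebraic_form X \<omega> \<longleftrightarrow>
    (\<exists>A. form_coefficients X \<omega> A \<and>
      (\<forall>p\<in>X. \<forall>u\<in>tangent_space X p. \<forall>v\<in>tangent_space X p. \<forall>w\<in>tangent_space X p.
        exterior_deriv A p u v w = 0))"

definition nondegenerate_form ::
    "(complex ^ 'n) set \<Rightarrow> (complex ^ 'n \<Rightarrow> complex ^ 'n \<Rightarrow> complex ^ 'n \<Rightarrow> complex) \<Rightarrow> bool" where
  "nondegenerate_form X \<omega> \<longleftrightarrow>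
    (\<forall>p\<in>X. \<forall>v\<in>tangent_space X p. (\<forall>w\<in>tangent_space X p. \<omega> p v w = 0) \<longrightarrow> v = 0)"

definition algebraic_symplectic_form ::
    "(complex ^ 'n) set \<Rightarrow> (complex ^ 'n \<Rightarrow> complex ^ 'n \<Rightarrow> complex ^ 'n \<Rightarrow> complex) \<Rightarrow> bool" where
  "algebraic_symplectic_form X \<omega> \<longleftrightarrow> closed_algebraic_form X \<omega> \<and> nondegenerate_form X \<omega>"


section \<open>The algebraic Hamiltonian density property\<close>

definition HVF_alg ::
    "(complex ^ 'n) set \<Rightarrow> (complex ^ 'n \<Rightarrow> complex ^ 'n \<Rightarrow> complex ^ 'n \<Rightarrow> complex) \<Rightarrow>
      (complex ^ 'n \<Rightarrow> complex ^ 'n) set" where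
  "HVF_alg X \<omega> = {V. algebraic_vector_field X V \<and>
    (\<exists>f. regular_fun X f \<and>
      (\<forall>p\<in>X. \<forall>w\<in>tangent_space X p. \<omega> p (V p) w = differential X f p w))}"

definition algebraic_hamiltonian_density_property ::
    "(complex ^ 'n) set \<Rightarrow> (complex ^ 'n \<Rightarrow> complex ^ 'n \<Rightarrow> complex ^ 'n \<Rightarrow> complex) \<Rightarrow> bool" where
  "algebraic_hamiltonian_density_property X \<omega> \<longleftrightarrow>
    lie_generated X {V \<in> HVF_alg X \<omega>. complete_vector_field X V} = HVF_alg X \<omega>"


section \<open>Products\<close>

text \<open>\<open>\<complex>\<^sup>n \<times> \<complex>\<^sup>m\<close> is identified with \<open>complex ^ ('n + 'm)\<close>.\<close>

definition proj_X :: "complex ^ ('n::finite + 'm::finite) \<Rightarrow> complex ^ 'n" where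
  "proj_X z = (\<chi> i. z $ Inl i)"

definition proj_Y :: "complex ^ ('n::finite + 'm::finite) \<Rightarrow> complex ^ 'm" where
  "proj_Y z = (\<chi> j. z $ Inr j)"

definition product_variety ::
    "(complex ^ 'n) set \<Rightarrow> (complex ^ 'm) set \<Rightarrow> (complex ^ ('n::finite + 'm::finite)) set" where
  "product_variety X Y = {z. proj_X z \<in> X \<and> proj_Y z \<in> Y}"

definition pullback_form ::
    "(complex ^ 'k \<Rightarrow> complex ^ 'n) \<Rightarrow> (complex ^ 'n \<Rightarrow> complex ^ 'n \<Rightarrow> complex ^ 'n \<Rightarrow> complex) \<Rightarrow>
      complex ^ 'k \<Rightarrow> complex ^ 'k \<Rightarrow> complex ^ 'k \<Rightarrow> complex" where
  "pullback_form \<phi> \<omega> z v w =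
    \<omega> (\<phi> z) (frechet_derivative \<phi> (at z) v) (frechet_derivative \<phi> (at z) w)"

definition product_form ::
    "(complex ^ 'n \<Rightarrow> complex ^ 'n \<Rightarrow> complex ^ 'n \<Rightarrow> complex) \<Rightarrow>
      (complex ^ 'm \<Rightarrow> complex ^ 'm \<Rightarrow> complex ^ 'm \<Rightarrow> complex) \<Rightarrow>
      complex ^ ('n::finite + 'm::finite) \<Rightarrow> complex ^ ('n + 'm) \<Rightarrow> complex ^ ('n + 'm) \<Rightarrow> complex" where
  "product_form \<omega>X \<omega>Y z v w = pullback_form proj_X \<omega>X z v w + pullback_form proj_Y \<omega>Y z v w"

end

theory Submission imports Defs begin

text \<open>Let \<open>L\<close> be the Lie algebra generated by the complete Hamiltonian fields on \<open>X \<times> Y\<close>.  Write \<open>H(X)\<close> for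
  the space of regular functions on \<open>X\<close> with an algebraic Hamiltonian field, and likewise for \<open>Y\<close> and
  \<open>X \<times> Y\<close>.

  Every field in \<open>L\<close> is Hamiltonian because the commutator of the Hamiltonian fields \<open>V\<close> of \<open>f\<close> and \<open>W\<close> of \<open>g\<close>
  is the Hamiltonian field of \<open>V(g)\<close> (lemma \<open>form_bracket\<close>).  This is Cartan's formula.  It needs an extension
  of a tangent vector to a tangent field, and smoothness provides a polynomial one
  (lemma \<open>smooth_extend_tangent\<close>).

  For the converse, the key observation is that a product \<open>a(x) b(y)\<close> of functions with complete Hamiltonian
  fields \<open>U\<close> and \<open>W\<close> has the complete Hamiltonian field \<open>(b U, a W)\<close>: a Hamiltonian function is constant along
  its own flow, so that the flows of \<open>U\<close> and \<open>W\<close> are just run through at constant speeds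
  (lemma \<open>complete_product_field\<close>).  In particular \<open>L\<close> contains the lifts of the complete fields on either
  factor.  Bracketing \<open>a(x) b(y)\<close> with a function \<open>c(x)\<close> is bracketing \<open>a\<close> with \<open>c\<close> on \<open>X\<close> and keeping \<open>b\<close>.
  Hence the density property of \<open>X\<close> frees the first factor of all completeness assumptions, and that of \<open>Y\<close>
  then frees the second one: \<open>L\<close> contains the Hamiltonian fields of all \<open>a(x) b(y)\<close> with \<open>a \<in> H(X)\<close>,
  \<open>b \<in> H(Y)\<close> (lemma \<open>product_field_in_L\<close>).

  It remains to write every \<open>f \<in> H(X \<times> Y)\<close> as a sum of such products.  As a polynomial, \<open>f\<close> is a sum of
  products \<open>a(x) b(y)\<close> with unrestricted factors.  All slices \<open>f(\<cdot>,y)\<close> are in \<open>H(X)\<close> and all slices \<open>f(x,\<cdot>)\<close> in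
  \<open>H(Y)\<close>, since the components of the Hamiltonian field of \<open>f\<close> are Hamiltonian fields of the slices.  By
  elimination the factors can be replaced by combinations of slices (lemma \<open>tensor_both_factors\<close>).  Since the
  symplectic form is nondegenerate, the Hamiltonian field of \<open>f\<close> is the sum of those of the products.\<close>


section \<open>Calculus of polynomial functions\<close>

abbreviation D :: "(complex ^ 'n \<Rightarrow> complex) \<Rightarrow> complex ^ 'n \<Rightarrow> complex ^ 'n \<Rightarrow> complex" where
  "D F p v \<equiv> frechet_derivative F (at p) v"

lemma poly_fun_has_derivative: "poly_fun F \<Longrightarrow> (F has_derivative D F p) (at p)"
  using poly_fun_differentiable frechet_derivative_works by blast

lemma D_const: "D (\<lambda>_. c) p v = 0"
  by simp

lemma D_coord: "D (\<lambda>p. p $ i) p v = v $ i"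
  using fun_cong[OF frechet_derivative_at[OF bounded_linear_imp_has_derivative[OF bounded_linear_vec_nth]], of v i p]
  by simp

lemma D_add:
  assumes "poly_fun F" "poly_fun G"
  shows "D (\<lambda>p. F p + G p) p v = D F p v + D G p v"
  using fun_cong[OF frechet_derivative_at[OF has_derivative_add[OF assms[THEN poly_fun_has_derivative[where p = p]]]], of v]
  by simp

lemma D_mult:
  assumes "poly_fun F" "poly_fun G"
  shows "D (\<lambda>p. F p * G p) p v = F p * D G p v + D F p v * G p"
  using fun_cong[OF frechet_derivative_at[OF has_derivative_mult[OF assms[THEN poly_fun_has_derivative[where p = p]]]], of v]
  by simp

lemmas D_simps = D_const D_coord D_add D_mult

lemma poly_fun_cmult: "poly_fun F \<Longrightarrow> poly_fun (\<lambda>p. c * F p)"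
  by (intro poly_fun.intros)

lemma poly_fun_diff:
  assumes "poly_fun F" "poly_fun G" shows "poly_fun (\<lambda>p. F p - G p)"
proof -
  have "poly_fun (\<lambda>p. F p + (-1) * G p)"
    by (intro poly_fun.intros assms)
  then show ?thesis by simp
qed

lemma poly_fun_sum:
  assumes "\<And>i. i \<in> I \<Longrightarrow> poly_fun (F i)" shows "poly_fun (\<lambda>p. \<Sum>i\<in>I. F i p)"
  using assms by (induction I rule: infinite_finite_induct) (auto intro: poly_fun.intros)

lemma poly_fun_power: "poly_fun F \<Longrightarrow> poly_fun (\<lambda>p. F p ^ N)"
  by (induction N) (auto intro: poly_fun.intros)

lemma D_cmult: "poly_fun F \<Longrightarrow> D (\<lambda>p. c * F p) p v = c * D F p v"
  by (simp add: D_simps poly_fun.intros)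

lemma D_sum:
  assumes "\<And>i. i \<in> I \<Longrightarrow> poly_fun (F i)"
  shows "D (\<lambda>p. \<Sum>i\<in>I. F i p) p v = (\<Sum>i\<in>I. D (F i) p v)"
  using assms
  by (induction I rule: infinite_finite_induct) (auto simp: D_simps poly_fun_sum)

lemma D_vadd: "poly_fun F \<Longrightarrow> D F p (v + w) = D F p v + D F p w"
  by (meson poly_fun_has_derivative has_derivative_bounded_linear bounded_linear.linear linear_add)

lemma D_vscale: "poly_fun F \<Longrightarrow> D F p (c *s v) = c * D F p v"
  by (induction rule: poly_fun.induct) (auto simp: D_simps algebra_simps)

lemma D_vzero: "poly_fun F \<Longrightarrow> D F p 0 = 0"
  using D_vscale[of F p 0 0] by simp

lemma D_vdiff: "poly_fun F \<Longrightarrow> D F p (v - w) = D F p v - D F p w"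
  using D_vadd[of F p "v - w" w] by simp

definition poly_field :: "(complex ^ 'n \<Rightarrow> complex ^ 'n) \<Rightarrow> bool" where
  "poly_field U \<longleftrightarrow> (\<forall>i. poly_fun (\<lambda>p. U p $ i))"

lemma poly_field_const: "poly_field (\<lambda>_. v)"
  by (simp add: poly_field_def poly_fun.intros)

lemma poly_field_add: "poly_field U \<Longrightarrow> poly_field V \<Longrightarrow> poly_field (\<lambda>p. U p + V p)"
  by (simp add: poly_field_def poly_fun.intros)

lemma poly_field_diff: "poly_field U \<Longrightarrow> poly_field V \<Longrightarrow> poly_field (\<lambda>p. U p - V p)"
  by (simp add: poly_field_def poly_fun_diff)

lemma poly_field_mult: "poly_fun h \<Longrightarrow> poly_field V \<Longrightarrow> poly_field (\<lambda>p. h p *s V p)"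
  by (simp add: poly_field_def poly_fun.intros)

lemma poly_fun_D: "poly_fun F \<Longrightarrow> poly_field U \<Longrightarrow> poly_fun (\<lambda>p. D F p (U p))"
  by (induction rule: poly_fun.induct) (auto simp: D_simps poly_field_def intro: poly_fun.intros)

definition field_deriv ::
    "(complex ^ 'n \<Rightarrow> complex ^ 'n) \<Rightarrow> complex ^ 'n \<Rightarrow> complex ^ 'n \<Rightarrow> complex ^ 'n" where
  "field_deriv V p u = (\<chi> i. D (\<lambda>q. V q $ i) p u)"

definition bracket ::
    "(complex ^ 'n \<Rightarrow> complex ^ 'n) \<Rightarrow> (complex ^ 'n \<Rightarrow> complex ^ 'n) \<Rightarrow> complex ^ 'n \<Rightarrow> complex ^ 'n"
  where "bracket V W p = field_deriv W p (V p) - field_deriv V p (W p)"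

lemma poly_field_bracket: "poly_field V \<Longrightarrow> poly_field W \<Longrightarrow> poly_field (bracket V W)"
  unfolding poly_field_def bracket_def field_deriv_def
  by (auto intro!: poly_fun_diff poly_fun_D simp: poly_field_def)

text \<open>Both sides are derivations in \<open>F\<close>, as the mixed terms \<open>(V F)(W G)\<close> cancel in the difference on the right,
  and they agree on the coordinates by definition of the bracket.\<close>

lemma D_bracket:
  assumes "poly_fun F" "poly_field V" "poly_field W"
  shows "D F p (bracket V W p) =
    D (\<lambda>q. D F q (W q)) p (V p) - D (\<lambda>q. D F q (V q)) p (W p)"
  using assms(1)
proof (induction rule: poly_fun.induct)
  case (const c)
  then show ?case by (simp add: D_const)
next
  case (coord i)
  then show ?case by (simp add: D_coord bracket_def field_deriv_def)
next
  case (add F G)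
  note [simp] = poly_fun_D[OF add.hyps(1) assms(2)] poly_fun_D[OF add.hyps(2) assms(2)]
    poly_fun_D[OF add.hyps(1) assms(3)] poly_fun_D[OF add.hyps(2) assms(3)] add.hyps
  show ?case by (simp add: D_simps add.IH)
next
  case (mult F G)
  note [simp] = poly_fun_D[OF mult.hyps(1) assms(2)] poly_fun_D[OF mult.hyps(2) assms(2)]
    poly_fun_D[OF mult.hyps(1) assms(3)] poly_fun_D[OF mult.hyps(2) assms(3)] mult.hyps
  show ?case by (simp add: D_simps mult.IH poly_fun.intros algebra_simps)
qed

lemma poly_fun_along_curve:
  assumes "poly_fun F"
    and "\<And>i. ((\<lambda>s. \<gamma> s $ i) has_field_derivative v $ i) (at t)"
  shows "((\<lambda>s. F (\<gamma> s)) has_field_derivative D F (\<gamma> t) v) (at t)"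
  using assms(1)
proof (induction rule: poly_fun.induct)
  case (mult F G)
  show ?case
    using DERIV_mult'[OF mult.IH] by (simp add: D_simps mult.hyps algebra_simps)
qed (auto simp: D_simps assms(2) intro: DERIV_add)


section \<open>Tangent fields\<close>

lemma tangent_add: "v \<in> tangent_space X p \<Longrightarrow> w \<in> tangent_space X p \<Longrightarrow> v + w \<in> tangent_space X p"
  by (simp add: tangent_space_def vanishing_ideal_def D_vadd)

lemma tangent_diff: "v \<in> tangent_space X p \<Longrightarrow> w \<in> tangent_space X p \<Longrightarrow> v - w \<in> tangent_space X p"
  by (simp add: tangent_space_def vanishing_ideal_def D_vdiff)

lemma tangent_scale: "v \<in> tangent_space X p \<Longrightarrow> c *s v \<in> tangent_space X p"
  by (simp add: tangent_space_def vanishing_ideal_def D_vscale)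

lemma tangent_zero: "0 \<in> tangent_space X p"
  by (simp add: tangent_space_def vanishing_ideal_def D_vzero)

definition tangent_field :: "(complex ^ 'n) set \<Rightarrow> (complex ^ 'n \<Rightarrow> complex ^ 'n) \<Rightarrow> bool" where
  "tangent_field X U \<longleftrightarrow> poly_field U \<and> (\<forall>p\<in>X. U p \<in> tangent_space X p)"

lemma D_eq_on:
  assumes "poly_fun F" "poly_fun G" "\<forall>q\<in>X. F q = G q" "v \<in> tangent_space X p"
  shows "D F p v = D G p v"
  using differential_eq[of F X F v p] differential_eq[of G X F v p] assms by simp

lemma D_vanishing: "F \<in> vanishing_ideal X \<Longrightarrow> v \<in> tangent_space X p \<Longrightarrow> D F p v = 0"
  by (simp add: tangent_space_def)

lemma bracket_tangent:
  assumes "tangent_field X V" "tangent_field X W"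
  shows "tangent_field X (bracket V W)"
proof -
  have 1: "(\<lambda>q. D F q (U q)) \<in> vanishing_ideal X"
    if "tangent_field X U" "F \<in> vanishing_ideal X" for U F
    using that by (auto simp: vanishing_ideal_def tangent_space_def tangent_field_def poly_fun_D)
  have "bracket V W p \<in> tangent_space X p" if "p \<in> X" for p
    unfolding tangent_space_def
  proof safe
    fix F assume F: "F \<in> vanishing_ideal X"
    then have "D F p (bracket V W p) =
        D (\<lambda>q. D F q (W q)) p (V p) - D (\<lambda>q. D F q (V q)) p (W p)"
      using assms by (intro D_bracket) (auto simp: vanishing_ideal_def tangent_field_def)
    also have "\<dots> = 0"
      using assms that 1[OF assms(1) F] 1[OF assms(2) F]
      by (simp add: D_vanishing tangent_field_def)
    finally show "D F p (bracket V W p) = 0" .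
  qed
  then show ?thesis
    using assms by (simp add: tangent_field_def poly_field_bracket)
qed


section \<open>Extending tangent vectors of a smooth variety\<close>

text \<open>Induction on the number of forms.  Either the last \<open>\<alpha>\<close> vanishes on the common kernel of the others and
  can be dropped, or some \<open>e\<close> in that kernel has \<open>\<alpha> e \<noteq> 0\<close>; then \<open>\<beta> - (\<beta> e / \<alpha> e) \<alpha>\<close> vanishes on the
  common kernel of the others.\<close>

lemma linear_form_in_span:
  fixes \<alpha> :: "nat \<Rightarrow> complex ^ 'n \<Rightarrow> complex"
  assumes "\<And>k v w. k < r \<Longrightarrow> \<alpha> k (v + w) = \<alpha> k v + \<alpha> k w"
    and "\<And>k c v. k < r \<Longrightarrow> \<alpha> k (c *s v) = c * \<alpha> k v"
    and "\<And>v w. \<beta> (v + w) = \<beta> v + \<beta> w" and "\<And>c v. \<beta> (c *s v) = c * \<beta> v"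
    and "\<And>v. (\<forall>k<r. \<alpha> k v = 0) \<Longrightarrow> \<beta> v = 0"
  shows "\<exists>c. \<forall>v. \<beta> v = (\<Sum>k<r. c k * \<alpha> k v)"
  using assms
proof (induction r arbitrary: \<beta>)
  case 0
  then show ?case by simp
next
  case (Suc r)
  show ?case
  proof (cases "\<exists>v. (\<forall>k<r. \<alpha> k v = 0) \<and> \<alpha> r v \<noteq> 0")
    case False
    have "\<exists>c. \<forall>v. \<beta> v = (\<Sum>k<r. c k * \<alpha> k v)"
      using False Suc.prems by (intro Suc.IH) (auto simp: less_Suc_eq)
    then obtain c where c: "\<forall>v. \<beta> v = (\<Sum>k<r. c k * \<alpha> k v)" ..
    have "\<forall>v. \<beta> v = (\<Sum>k<Suc r. (c(r := 0)) k * \<alpha> k v)"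
      using c by simp
    then show ?thesis by blast
  next
    case True
    then obtain e where e: "\<forall>k<r. \<alpha> k e = 0" "\<alpha> r e \<noteq> 0" by blast
    define b where "b = \<beta> e / \<alpha> r e"
    have "\<exists>c. \<forall>v. \<beta> v - b * \<alpha> r v = (\<Sum>k<r. c k * \<alpha> k v)"
    proof (rule Suc.IH)
      fix v assume v: "\<forall>k<r. \<alpha> k v = 0"
      define d where "d = - (\<alpha> r v / \<alpha> r e)"
      have d: "d * \<alpha> r e = - \<alpha> r v" using e by (simp add: d_def)
      let ?w = "v + d *s e"
      have "\<forall>k<Suc r. \<alpha> k ?w = 0"
        using v e by (auto simp: Suc.prems(1,2) less_Suc_eq d)
      then have "\<beta> ?w = 0" by (rule Suc.prems(5))
      then have "\<beta> v + d * \<beta> e = 0" by (simp only: Suc.prems(3,4))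
      then show "\<beta> v - b * \<alpha> r v = 0" by (simp add: b_def d_def)
    qed (use Suc.prems in \<open>auto simp: algebra_simps\<close>)
    then obtain c where c: "\<forall>v. \<beta> v - b * \<alpha> r v = (\<Sum>k<r. c k * \<alpha> k v)" ..
    have "\<forall>v. \<beta> v = (\<Sum>k<Suc r. (c(r := b)) k * \<alpha> k v)"
    proof
      fix v
      show "\<beta> v = (\<Sum>k<Suc r. (c(r := b)) k * \<alpha> k v)"
        using c[rule_format, of v] by (simp add: algebra_simps)
    qed
    then show ?thesis by blast
  qed
qed

text \<open>One equation is solved at a time, without denominators: if fields \<open>U\<close> and \<open>E\<close> are killed by the first
  \<open>r\<close> differentials and \<open>df\<close> is the next one, then \<open>(df E) U - (df U) E\<close> is killed by \<open>df\<close> as well.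
  Independence at \<open>p\<close> provides an \<open>E\<close> with \<open>df E\<close> nonzero at \<open>p\<close>, where the new field is therefore a
  nonzero multiple of \<open>U\<close>.\<close>

lemma extend_common_kernel:
  fixes f :: "nat \<Rightarrow> complex ^ 'n \<Rightarrow> complex"
  assumes "\<And>k. k < r \<Longrightarrow> poly_fun (f k)"
    and "\<And>c. (\<forall>v. (\<Sum>k<r. c k * D (f k) p v) = 0) \<Longrightarrow> \<forall>k<r. c k = 0"
    and "\<And>k. k < r \<Longrightarrow> D (f k) p u = 0"
  shows "\<exists>U. poly_field U \<and> U p = u \<and> (\<forall>q. \<forall>k<r. D (f k) q (U q) = 0)"
  using assms
proof (induction r arbitrary: u)
  case 0
  then show ?case by (auto intro!: exI[of _ "\<lambda>_. u"] poly_field_const)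
next
  case (Suc r)
  have indep: "\<forall>k<r. c k = 0" if "\<forall>v. (\<Sum>k<r. c k * D (f k) p v) = 0" for c
    using Suc.prems(2)[of "c(r := 0)"] that by (auto simp: less_Suc_eq)
  have "\<exists>e. (\<forall>k<r. D (f k) p e = 0) \<and> D (f r) p e \<noteq> 0"
  proof (rule ccontr)
    assume "\<not> ?thesis"
    then have "\<exists>c. \<forall>v. D (f r) p v = (\<Sum>k<r. c k * D (f k) p v)"
      using Suc.prems(1) by (intro linear_form_in_span) (auto simp: D_vadd D_vscale)
    then obtain c where c: "\<forall>v. D (f r) p v = (\<Sum>k<r. c k * D (f k) p v)" ..
    have "\<forall>v. (\<Sum>k<Suc r. (c(r := -1)) k * D (f k) p v) = 0"
      using c by simp
    from Suc.prems(2)[OF this] show False by auto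
  qed
  then obtain e where e: "\<forall>k<r. D (f k) p e = 0" and er: "D (f r) p e \<noteq> 0" by blast
  obtain E where E: "poly_field E" "E p = e" "\<forall>q. \<forall>k<r. D (f k) q (E q) = 0"
    using Suc.IH[of e] Suc.prems(1) indep e by auto
  obtain U where U: "poly_field U" "U p = u" "\<forall>q. \<forall>k<r. D (f k) q (U q) = 0"
    using Suc.IH[of u] Suc.prems indep by auto
  define c where "c = 1 / D (f r) p e"
  define W where "W q = (c * D (f r) q (E q)) *s U q - (c * D (f r) q (U q)) *s E q" for q
  have "poly_field W"
    unfolding W_def using E U Suc.prems(1)
    by (intro poly_field_diff poly_field_mult poly_fun_cmult poly_fun_D) auto
  moreover have "W p = u"
    using Suc.prems(3)[of r] er by (simp add: W_def E U c_def)
  moreover have "D (f k) q (W q) = 0" if "k < Suc r" for q k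
    using that Suc.prems(1)[OF that] E U
    by (auto simp: W_def D_vdiff D_vscale less_Suc_eq)
  ultimately show ?case by blast
qed

text \<open>Near \<open>p\<close> the tangent spaces are cut out by the chosen generators of the ideal, so that a field
  killed by their differentials is tangent there; multiplying it by the localising polynomial \<open>h\<close> makes it
  tangent on all of \<open>X\<close>.\<close>

lemma smooth_extend_tangent:
  assumes "smooth_at X p" "p \<in> X" "u \<in> tangent_space X p"
  shows "\<exists>U. tangent_field X U \<and> U p = u"
proof -
  obtain r :: nat and f h where f: "\<forall>k<r. f k \<in> vanishing_ideal X" and h: "poly_fun h" "h p \<noteq> 0"
    and gen: "\<forall>G\<in>vanishing_ideal X. \<exists>N a. (\<forall>k<r. poly_fun (a k)) \<and>
          (\<forall>q. h q ^ N * G q = (\<Sum>k<r. a k q * f k q))"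
    and indep: "\<forall>c. (\<forall>v. (\<Sum>k<r. c k * D (f k) p v) = 0) \<longrightarrow> (\<forall>k<r. c k = 0)"
    using assms(1) unfolding smooth_at_def by blast
  have pf: "poly_fun (f k)" if "k < r" for k
    using f that by (auto simp: vanishing_ideal_def)
  have "\<exists>U. poly_field U \<and> U p = u \<and> (\<forall>q. \<forall>k<r. D (f k) q (U q) = 0)"
    using indep f assms(3) by (intro extend_common_kernel pf) (auto simp: D_vanishing)
  then obtain U where U: "poly_field U" "U p = u" "\<forall>q. \<forall>k<r. D (f k) q (U q) = 0" by blast
  have tang: "U q \<in> tangent_space X q" if q: "q \<in> X" "h q \<noteq> 0" for q
    unfolding tangent_space_def
  proof safe
    fix G assume G: "G \<in> vanishing_ideal X"
    then obtain N a where a: "\<forall>k<r. poly_fun (a k)"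
        "\<forall>q. h q ^ N * G q = (\<Sum>k<r. a k q * f k q)"
      using gen by blast
    have G': "poly_fun G" "G q = 0" using G q by (auto simp: vanishing_ideal_def)
    have "h q ^ N * D G q (U q) = D (\<lambda>q. h q ^ N * G q) q (U q)"
      using G' h by (simp add: D_mult poly_fun_power)
    also have "\<dots> = D (\<lambda>q. \<Sum>k<r. a k q * f k q) q (U q)"
      using a(2) by simp
    also have "\<dots> = (\<Sum>k<r. D (\<lambda>q. a k q * f k q) q (U q))"
      using a(1) pf by (intro D_sum) (auto intro: poly_fun.intros)
    also have "\<dots> = 0"
      using a(1) pf U(3) f q by (intro sum.neutral) (auto simp: D_mult vanishing_ideal_def)
    finally show "D G q (U q) = 0" using q by simp
  qed
  define W where "W q = (h q / h p) *s U q" for q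
  have "tangent_field X W"
    unfolding tangent_field_def
  proof safe
    have "poly_field (\<lambda>q. (inverse (h p) * h q) *s U q)"
      using h U by (intro poly_field_mult poly_fun_cmult)
    then show "poly_field W" unfolding W_def by (simp add: field_simps)
    fix q assume "q \<in> X"
    then show "W q \<in> tangent_space X q"
      using tang[of q] by (cases "h q = 0") (auto simp: W_def tangent_zero tangent_scale)
  qed
  moreover have "W p = u" using h U by (simp add: W_def)
  ultimately show ?thesis by blast
qed


section \<open>Hamiltonian vector fields\<close>

definition restrict_field :: "(complex ^ 'n) set \<Rightarrow> (complex ^ 'n \<Rightarrow> complex ^ 'n) \<Rightarrow>
    complex ^ 'n \<Rightarrow> complex ^ 'n" where
  "restrict_field X U p = (if p \<in> X then U p else 0)"

lemma algebraic_vector_field_iff: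
  "algebraic_vector_field X V \<longleftrightarrow> (\<exists>U. tangent_field X U \<and> V = restrict_field X U)"
proof
  assume V: "algebraic_vector_field X V"
  then obtain F where F: "\<And>i. poly_fun (F i) \<and> (\<forall>p\<in>X. V p $ i = F i p)"
    unfolding algebraic_vector_field_def regular_fun_def by metis
  define U where "U p = (\<chi> i. F i p)" for p
  have eq: "U p = V p" if "p \<in> X" for p
    using F that by (simp add: U_def vec_eq_iff)
  have "tangent_field X U"
    using V F eq by (auto simp: tangent_field_def poly_field_def U_def algebraic_vector_field_def)
  moreover have "V = restrict_field X U"
    using V eq by (auto simp: restrict_field_def algebraic_vector_field_def)
  ultimately show "\<exists>U. tangent_field X U \<and> V = restrict_field X U" by blast
next
  assume "\<exists>U. tangent_field X U \<and> V = restrict_field X U"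
  then show "algebraic_vector_field X V"
    by (auto simp: tangent_field_def poly_field_def restrict_field_def algebraic_vector_field_def
        regular_fun_def)
qed

lemma commutator_restrict_field:
  assumes "tangent_field X V" "tangent_field X W"
  shows "commutator X (restrict_field X V) (restrict_field X W) = restrict_field X (bracket V W)"
proof
  fix p
  have "differential X (\<lambda>q. restrict_field X W q $ i) p v = D (\<lambda>q. W q $ i) p v"
    if "v \<in> tangent_space X p" "tangent_field X W" for v i W
    using that
    by (intro differential_eq) (auto simp: restrict_field_def tangent_field_def poly_field_def)
  then show "commutator X (restrict_field X V) (restrict_field X W) p =
      restrict_field X (bracket V W) p"
    using assms
    by (auto simp: commutator_def restrict_field_def bracket_def field_deriv_def vec_eq_iff
        tangent_field_def)
qed

text \<open>A pair of a function and its Hamiltonian field, given by polynomial extensions of both; the field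
  itself is zero outside \<open>X\<close>, so that it is determined as a function on the ambient space.\<close>

definition hamiltonian ::
    "(complex ^ 'n) set \<Rightarrow> (complex ^ 'n \<Rightarrow> complex ^ 'n \<Rightarrow> complex ^ 'n \<Rightarrow> complex) \<Rightarrow>
      (complex ^ 'n \<Rightarrow> complex) \<Rightarrow> (complex ^ 'n \<Rightarrow> complex ^ 'n) \<Rightarrow> bool" where
  "hamiltonian X \<omega> f V \<longleftrightarrow> (\<exists>F U. poly_fun F \<and> (\<forall>q\<in>X. f q = F q) \<and> tangent_field X U \<and>
    V = restrict_field X U \<and> (\<forall>p\<in>X. \<forall>w\<in>tangent_space X p. \<omega> p (U p) w = D F p w))"

lemma hamiltonianI:
  assumes "poly_fun F" "\<And>q. q \<in> X \<Longrightarrow> f q = F q" "tangent_field X U"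
    "\<And>q. q \<in> X \<Longrightarrow> V q = U q" "\<And>q. q \<notin> X \<Longrightarrow> V q = 0"
    "\<And>p w. p \<in> X \<Longrightarrow> w \<in> tangent_space X p \<Longrightarrow> \<omega> p (U p) w = D F p w"
  shows "hamiltonian X \<omega> f V"
proof -
  have "V = restrict_field X U" using assms by (auto simp: restrict_field_def)
  then show ?thesis using assms unfolding hamiltonian_def by blast
qed

lemma hamiltonianE:
  assumes "hamiltonian X \<omega> f V"
  obtains F U where "poly_fun F" "\<And>q. q \<in> X \<Longrightarrow> f q = F q" "tangent_field X U"
    "V = restrict_field X U" "\<And>q. q \<in> X \<Longrightarrow> V q = U q" "\<And>q. q \<notin> X \<Longrightarrow> V q = 0"
    "\<And>p w. p \<in> X \<Longrightarrow> w \<in> tangent_space X p \<Longrightarrow> \<omega> p (U p) w = D F p w"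
  using assms unfolding hamiltonian_def by (force simp: restrict_field_def)

lemma hamiltonian_cong:
  "hamiltonian X \<omega> f V \<Longrightarrow> (\<And>q. q \<in> X \<Longrightarrow> f q = g q) \<Longrightarrow> hamiltonian X \<omega> g V"
  unfolding hamiltonian_def by fastforce

lemma HVF_alg_iff: "V \<in> HVF_alg X \<omega> \<longleftrightarrow> (\<exists>f. hamiltonian X \<omega> f V)"
proof
  assume "V \<in> HVF_alg X \<omega>"
  then obtain f F U where f: "tangent_field X U" "V = restrict_field X U" "poly_fun F"
    "\<forall>q\<in>X. f q = F q" "\<forall>p\<in>X. \<forall>w\<in>tangent_space X p. \<omega> p (V p) w = differential X f p w"
    unfolding HVF_alg_def algebraic_vector_field_iff regular_fun_def by blast
  then have "hamiltonian X \<omega> f V"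
    using differential_eq[OF f(3,4)]
    by (intro hamiltonianI[of F _ _ U]) (auto simp: restrict_field_def)
  then show "\<exists>f. hamiltonian X \<omega> f V" by blast
next
  assume "\<exists>f. hamiltonian X \<omega> f V"
  then obtain f where "hamiltonian X \<omega> f V" by blast
  then obtain F U where F: "poly_fun F" "\<And>q. q \<in> X \<Longrightarrow> f q = F q" "tangent_field X U"
    "V = restrict_field X U" "\<And>q. q \<in> X \<Longrightarrow> V q = U q"
    "\<And>p w. p \<in> X \<Longrightarrow> w \<in> tangent_space X p \<Longrightarrow> \<omega> p (U p) w = D F p w"
    by (rule hamiltonianE) blast
  have "\<omega> p (V p) w = differential X f p w" if "p \<in> X" "w \<in> tangent_space X p" for p w
    using F that differential_eq[of F X f w p] by auto
  moreover have "regular_fun X f" using F(1,2) by (auto simp: regular_fun_def)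
  moreover have "algebraic_vector_field X V"
    using F(3,4) by (auto simp: algebraic_vector_field_iff)
  ultimately show "V \<in> HVF_alg X \<omega>" unfolding HVF_alg_def by blast
qed

definition form_of :: "('n \<Rightarrow> 'n \<Rightarrow> complex ^ 'n \<Rightarrow> complex) \<Rightarrow>
    complex ^ 'n \<Rightarrow> complex ^ 'n \<Rightarrow> complex ^ 'n \<Rightarrow> complex" where
  "form_of A p v w = (\<Sum>i\<in>UNIV. \<Sum>j\<in>UNIV. A i j p * v $ i * w $ j)"

lemma form_of_add_left: "form_of A p (v + v') w = form_of A p v w + form_of A p v' w"
  and form_of_diff_left: "form_of A p (v - v') w = form_of A p v w - form_of A p v' w"
  and form_of_diff_right: "form_of A p v (w - w') = form_of A p v w - form_of A p v w'"
  and form_of_scale_left: "form_of A p (c *s v) w = c * form_of A p v w"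
  by (simp_all add: form_of_def algebra_simps sum.distrib sum_subtractf sum_distrib_left)

lemma form_of_skew:
  assumes "\<And>i j p. A i j p = - A j i p"
  shows "form_of A p v w = - form_of A p w v"
proof -
  have "form_of A p v w = (\<Sum>j\<in>UNIV. \<Sum>i\<in>UNIV. A i j p * v $ i * w $ j)"
    unfolding form_of_def by (rule sum.swap)
  also have "\<dots> = (\<Sum>j\<in>UNIV. \<Sum>i\<in>UNIV. - (A j i p * w $ j * v $ i))"
    by (intro sum.cong refl) (subst assms, simp)
  also have "\<dots> = - form_of A p w v"
    by (simp add: form_of_def sum_negf)
  finally show ?thesis .
qed

lemma exterior_deriv_eq:
  "exterior_deriv A p u v w = form_of (\<lambda>i j q. D (A i j) q u) p v w
    + form_of (\<lambda>i j q. D (A i j) q v) p w u + form_of (\<lambda>i j q. D (A i j) q w) p u v"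
  by (simp add: exterior_deriv_def form_of_def sum.distrib)

lemma poly_fun_form_of:
  assumes "\<And>i j. poly_fun (A i j)" "poly_field V" "poly_field W"
  shows "poly_fun (\<lambda>q. form_of A q (V q) (W q))"
  using assms unfolding form_of_def poly_field_def
  by (intro poly_fun_sum poly_fun.mult) auto

lemma D_form_of:
  assumes "\<And>i j. poly_fun (A i j)" "poly_field V" "poly_field W"
  shows "D (\<lambda>q. form_of A q (V q) (W q)) p u = form_of (\<lambda>i j q. D (A i j) q u) p (V p) (W p)
    + form_of A p (field_deriv V p u) (W p) + form_of A p (V p) (field_deriv W p u)"
proof -
  have pf: "poly_fun (\<lambda>q. V q $ i)" "poly_fun (\<lambda>q. W q $ i)" for i
    using assms by (auto simp: poly_field_def)
  show ?thesis
    unfolding form_of_def field_deriv_def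
    by (simp add: D_sum D_mult poly_fun_sum poly_fun.mult pf assms(1) sum.distrib[symmetric]
        algebra_simps)
qed

text \<open>Smoothness enters through its consequence that tangent vectors extend to tangent fields, a property
  that passes to products at once: one extends the two components separately.\<close>

locale symplectic_variety =
  fixes X :: "(complex ^ 'n) set"
    and \<omega> :: "complex ^ 'n \<Rightarrow> complex ^ 'n \<Rightarrow> complex ^ 'n \<Rightarrow> complex"
    and A :: "'n \<Rightarrow> 'n \<Rightarrow> complex ^ 'n \<Rightarrow> complex"
  assumes coefficients: "form_coefficients X \<omega> A"
    and closed: "\<And>p u v w. \<lbrakk>p \<in> X; u \<in> tangent_space X p; v \<in> tangent_space X p;
      w \<in> tangent_space X p\<rbrakk> \<Longrightarrow> exterior_deriv A p u v w = 0"
    and nondegenerate: "nondegenerate_form X \<omega>"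
    and extend_tangent:
      "\<And>p u. \<lbrakk>p \<in> X; u \<in> tangent_space X p\<rbrakk> \<Longrightarrow> \<exists>U. tangent_field X U \<and> U p = u"

lemma symplectic_varietyI:
  assumes "smooth_affine_variety X" "algebraic_symplectic_form X \<omega>"
  obtains A where "symplectic_variety X \<omega> A"
proof -
  obtain A where "form_coefficients X \<omega> A"
    "\<forall>p\<in>X. \<forall>u\<in>tangent_space X p. \<forall>v\<in>tangent_space X p. \<forall>w\<in>tangent_space X p.
        exterior_deriv A p u v w = 0"
    using assms(2) unfolding algebraic_symplectic_form_def closed_algebraic_form_def by blast
  then have "symplectic_variety X \<omega> A"
    using assms
    by unfold_locales
      (auto simp: algebraic_symplectic_form_def smooth_affine_variety_def smooth_extend_tangent)
  then show thesis by (rule that)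
qed

context symplectic_variety
begin

lemma A_poly: "poly_fun (A i j)"
  using coefficients unfolding form_coefficients_def by blast

lemma A_skew: "A i j p = - A j i p"
  using coefficients unfolding form_coefficients_def by blast

lemma form_skew: "form_of A p v w = - form_of A p w v"
  by (intro form_of_skew A_skew)

lemma form_eq:
  "\<lbrakk>p \<in> X; v \<in> tangent_space X p; w \<in> tangent_space X p\<rbrakk> \<Longrightarrow> \<omega> p v w = form_of A p v w"
  using coefficients unfolding form_coefficients_def form_of_def by blast

lemma form_add_left:
  assumes "p \<in> X" "v \<in> tangent_space X p" "v' \<in> tangent_space X p" "w \<in> tangent_space X p"
  shows "\<omega> p (v + v') w = \<omega> p v w + \<omega> p v' w"
  using assms by (simp add: form_eq tangent_add form_of_add_left)

lemma form_scale_left: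
  assumes "p \<in> X" "v \<in> tangent_space X p" "w \<in> tangent_space X p"
  shows "\<omega> p (c *s v) w = c * \<omega> p v w"
  using assms by (simp add: form_eq tangent_scale form_of_scale_left)

lemma form_zero_right: "p \<in> X \<Longrightarrow> v \<in> tangent_space X p \<Longrightarrow> \<omega> p v 0 = 0"
  by (simp add: form_eq tangent_zero form_of_def)

lemma form_diag: "p \<in> X \<Longrightarrow> v \<in> tangent_space X p \<Longrightarrow> \<omega> p v v = 0"
  using form_skew[of p v v] by (simp add: form_eq)

lemma hamiltonian_unique:
  assumes "hamiltonian X \<omega> f V" "hamiltonian X \<omega> f W"
  shows "V = W"
proof -
  obtain F U where F: "poly_fun F" "\<And>q. q \<in> X \<Longrightarrow> f q = F q" "tangent_field X U"
    "V = restrict_field X U"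
    "\<And>p w. p \<in> X \<Longrightarrow> w \<in> tangent_space X p \<Longrightarrow> \<omega> p (U p) w = D F p w"
    using assms(1) by (rule hamiltonianE) blast
  obtain G T where G: "poly_fun G" "\<And>q. q \<in> X \<Longrightarrow> f q = G q" "tangent_field X T"
    "W = restrict_field X T"
    "\<And>p w. p \<in> X \<Longrightarrow> w \<in> tangent_space X p \<Longrightarrow> \<omega> p (T p) w = D G p w"
    using assms(2) by (rule hamiltonianE) blast
  have "U p - T p = 0" if p: "p \<in> X" for p
  proof -
    have t: "U p \<in> tangent_space X p" "T p \<in> tangent_space X p"
      using F G p by (auto simp: tangent_field_def)
    have "\<omega> p (U p - T p) w = 0" if w: "w \<in> tangent_space X p" for w
    proof -
      have "D F p w = D G p w"
        using F(1,2) G(1,2) w by (intro D_eq_on[of _ _ X]) auto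
      then show ?thesis
        using F(5)[OF p w] G(5)[OF p w] p t w by (simp add: form_eq tangent_diff form_of_diff_left)
    qed
    then show ?thesis
      using nondegenerate p t tangent_diff unfolding nondegenerate_form_def by blast
  qed
  then show ?thesis by (auto simp: F(4) G(4) restrict_field_def)
qed

lemma hamiltonian_add:
  assumes "hamiltonian X \<omega> f V" "hamiltonian X \<omega> g W"
  shows "hamiltonian X \<omega> (\<lambda>p. f p + g p) (\<lambda>p. V p + W p)"
proof -
  obtain F U where F: "poly_fun F" "\<And>q. q \<in> X \<Longrightarrow> f q = F q" "tangent_field X U"
    "\<And>q. q \<in> X \<Longrightarrow> V q = U q" "\<And>q. q \<notin> X \<Longrightarrow> V q = 0"
    "\<And>p w. p \<in> X \<Longrightarrow> w \<in> tangent_space X p \<Longrightarrow> \<omega> p (U p) w = D F p w"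
    using assms(1) by (rule hamiltonianE) blast
  obtain G T where G: "poly_fun G" "\<And>q. q \<in> X \<Longrightarrow> g q = G q" "tangent_field X T"
    "\<And>q. q \<in> X \<Longrightarrow> W q = T q" "\<And>q. q \<notin> X \<Longrightarrow> W q = 0"
    "\<And>p w. p \<in> X \<Longrightarrow> w \<in> tangent_space X p \<Longrightarrow> \<omega> p (T p) w = D G p w"
    using assms(2) by (rule hamiltonianE) blast
  show ?thesis
    using F G
    by (intro hamiltonianI[of "\<lambda>p. F p + G p" _ _ "\<lambda>p. U p + T p"])
      (auto simp: poly_fun.add poly_field_add tangent_add tangent_field_def form_add_left D_add)
qed

lemma hamiltonian_scale:
  assumes "hamiltonian X \<omega> f V"
  shows "hamiltonian X \<omega> (\<lambda>p. c * f p) (\<lambda>p. c *s V p)"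
proof -
  obtain F U where F: "poly_fun F" "\<And>q. q \<in> X \<Longrightarrow> f q = F q" "tangent_field X U"
    "\<And>q. q \<in> X \<Longrightarrow> V q = U q" "\<And>q. q \<notin> X \<Longrightarrow> V q = 0"
    "\<And>p w. p \<in> X \<Longrightarrow> w \<in> tangent_space X p \<Longrightarrow> \<omega> p (U p) w = D F p w"
    using assms(1) by (rule hamiltonianE) blast
  show ?thesis
    using F
    by (intro hamiltonianI[of "\<lambda>p. c * F p" _ _ "\<lambda>p. c *s U p"])
      (auto simp: poly_fun_cmult poly_field_mult poly_fun.const tangent_scale tangent_field_def
        form_scale_left D_cmult)
qed

lemma hamiltonian_const: "hamiltonian X \<omega> (\<lambda>_. c) (\<lambda>_. 0)"
  using form_scale_left[of _ 0 _ 0]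
  by (intro hamiltonianI[of "\<lambda>_. c" _ _ "\<lambda>_. 0"])
    (auto simp: poly_fun.const poly_field_const tangent_field_def tangent_zero D_const)

text \<open>Cartan's formula for \<open>0 = d\<omega>(U,V,W)\<close>, where \<open>U\<close> extends the given tangent vector to a tangent field.
  As \<open>V\<close> and \<open>W\<close> are the Hamiltonian fields of \<open>F\<close> and \<open>G\<close>, every term but \<open>\<omega>([V,W],U)\<close> becomes an
  iterated derivative of \<open>F\<close> or \<open>G\<close>, and these sum up to \<open>U(V G)\<close>.  So the bracket is Hamiltonian, with
  function \<open>V G\<close>.\<close>

lemma form_bracket:
  assumes F: "poly_fun F" "tangent_field X V"
      "\<And>q w. q \<in> X \<Longrightarrow> w \<in> tangent_space X q \<Longrightarrow> \<omega> q (V q) w = D F q w"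
    and G: "poly_fun G" "tangent_field X W"
      "\<And>q w. q \<in> X \<Longrightarrow> w \<in> tangent_space X q \<Longrightarrow> \<omega> q (W q) w = D G q w"
    and p: "p \<in> X" and u: "u \<in> tangent_space X p"
  shows "\<omega> p (bracket V W p) u = D (\<lambda>q. D G q (V q)) p u"
proof -
  obtain U where U: "tangent_field X U" "U p = u" using extend_tangent p u by blast
  note pf = F(2)[unfolded tangent_field_def, THEN conjunct1]
    G(2)[unfolded tangent_field_def, THEN conjunct1]
    U(1)[unfolded tangent_field_def, THEN conjunct1]
  have t: "V q \<in> tangent_space X q" "W q \<in> tangent_space X q" "U q \<in> tangent_space X q"
    if "q \<in> X" for q
    using F G U that by (auto simp: tangent_field_def)
  let ?B = "form_of A" and ?dA = "\<lambda>u. form_of (\<lambda>i j q. D (A i j) q u)"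
  note leibniz = D_form_of[where A = A, OF A_poly]
  have closed_p: "?dA (U p) p (V p) (W p) + ?dA (V p) p (W p) (U p) + ?dA (W p) p (U p) (V p) = 0"
    using closed[of p "U p" "V p" "W p"] p t unfolding exterior_deriv_eq by blast
  have BV: "?B q (V q) w = D F q w" and BW: "?B q (W q) w = D G q w"
    if "q \<in> X" "w \<in> tangent_space X q" for q w
    using that F(3) G(3) t form_eq by metis+
  \<comment> \<open>The equations \<open>\<omega>(V,\<cdot>) = dF\<close> and \<open>\<omega>(W,\<cdot>) = dG\<close> hold on \<open>X\<close> and for tangent vectors only; they may be
    differentiated because the differentiation is along tangent vectors of \<open>X\<close>.\<close>
  have 1: "D (\<lambda>q. ?B q (V q) (W q)) p (U p) = D (\<lambda>q. -1 * D G q (V q)) p (U p)"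
    using p t BW form_skew[of _ "V _" "W _"] pf G
    by (intro D_eq_on[of _ _ X] poly_fun_form_of A_poly poly_fun_cmult poly_fun_D) auto
  have 0: "D (\<lambda>q. ?B q (V q) (W q)) p (U p) = D (\<lambda>q. D F q (W q)) p (U p)"
    using p t BV pf F
    by (intro D_eq_on[of _ _ X] poly_fun_form_of A_poly poly_fun_cmult poly_fun_D) auto
  have 2: "D (\<lambda>q. ?B q (W q) (U q)) p (V p) = D (\<lambda>q. D G q (U q)) p (V p)"
    using p t BW pf G
    by (intro D_eq_on[of _ _ X] poly_fun_form_of A_poly poly_fun_D) auto
  have 3: "D (\<lambda>q. ?B q (U q) (V q)) p (W p) = D (\<lambda>q. -1 * D F q (U q)) p (W p)"
    using p t BV form_skew[of _ "U _" "V _"] pf F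
    by (intro D_eq_on[of _ _ X] poly_fun_form_of A_poly poly_fun_cmult poly_fun_D) auto
  have VU: "tangent_field X (bracket V U)" and UW: "tangent_field X (bracket U W)"
    and VW: "tangent_field X (bracket V W)"
    using F(2) G(2) U(1) bracket_tangent by blast+
  have 4: "?B p (W p) (bracket V U p) = D (\<lambda>q. D G q (U q)) p (V p) - D (\<lambda>q. D G q (V q)) p (U p)"
    using BW[of p] VU p D_bracket[OF G(1) pf(1,3)] by (simp add: tangent_field_def)
  have 5: "?B p (V p) (bracket U W p) = D (\<lambda>q. D F q (W q)) p (U p) - D (\<lambda>q. D F q (U q)) p (W p)"
    using BV[of p] UW p D_bracket[OF F(1) pf(3,2)] by (simp add: tangent_field_def)
  have 6: "D (\<lambda>q. -1 * D G q (V q)) p (U p) = - D (\<lambda>q. D G q (V q)) p (U p)"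
    "D (\<lambda>q. -1 * D F q (U q)) p (W p) = - D (\<lambda>q. D F q (U q)) p (W p)"
    using D_cmult[OF poly_fun_D[OF G(1) pf(1)], of "-1"]
      D_cmult[OF poly_fun_D[OF F(1) pf(3)], of "-1"] by auto
  have "?B p (bracket V W p) (U p) = D (\<lambda>q. D G q (V q)) p (U p)"
    using closed_p 4 5
      leibniz[OF pf(1,2), of p "U p"] leibniz[OF pf(2,3), of p "V p"] leibniz[OF pf(3,1), of p "W p"]
      form_skew[of p "field_deriv V p (U p)" "W p"] form_skew[of p "field_deriv U p (W p)" "V p"]
      form_skew[of p "field_deriv V p (W p)" "U p"] 0
    unfolding 1 2 3 6 bracket_def form_of_diff_left form_of_diff_right by algebra
  then show ?thesis
    using U(2) VW p u form_eq by (simp add: tangent_field_def)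
qed

lemma hamiltonian_commutator:
  assumes "hamiltonian X \<omega> f V" "hamiltonian X \<omega> g W"
  shows "hamiltonian X \<omega> (\<lambda>p. differential X g p (V p)) (commutator X V W)"
proof -
  obtain F U where F: "poly_fun F" "\<And>q. q \<in> X \<Longrightarrow> f q = F q" "tangent_field X U"
    "V = restrict_field X U"
    "\<And>p w. p \<in> X \<Longrightarrow> w \<in> tangent_space X p \<Longrightarrow> \<omega> p (U p) w = D F p w"
    using assms(1) by (rule hamiltonianE) blast
  obtain G T where G: "poly_fun G" "\<And>q. q \<in> X \<Longrightarrow> g q = G q" "tangent_field X T"
    "W = restrict_field X T"
    "\<And>p w. p \<in> X \<Longrightarrow> w \<in> tangent_space X p \<Longrightarrow> \<omega> p (T p) w = D G p w"
    using assms(2) by (rule hamiltonianE) blast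
  show ?thesis
  proof (rule hamiltonianI[of "\<lambda>q. D G q (U q)" _ _ "bracket U T"])
    show "poly_fun (\<lambda>q. D G q (U q))"
      using F(3) G(1) by (auto simp: tangent_field_def intro: poly_fun_D)
    show "differential X g q (V q) = D G q (U q)" if "q \<in> X" for q
      using that F(3,4) G(1,2) differential_eq[of G X g "U q" q]
      by (simp add: restrict_field_def tangent_field_def)
    show "\<omega> p (bracket U T p) w = D (\<lambda>q. D G q (U q)) p w"
      if "p \<in> X" "w \<in> tangent_space X p" for p w
      using form_bracket[OF F(1,3,5) G(1,3,5) that] .
  qed (use F(3,4) G(3,4) in \<open>auto simp: bracket_tangent commutator_restrict_field restrict_field_def\<close>)
qed

lemma lie_generated_subset_HVF_alg:
  assumes "S \<subseteq> HVF_alg X \<omega>"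
  shows "lie_generated X S \<subseteq> HVF_alg X \<omega>"
proof
  fix V assume "V \<in> lie_generated X S"
  then show "V \<in> HVF_alg X \<omega>"
  proof (induction rule: lie_generated.induct)
    case zero
    show ?case using hamiltonian_const HVF_alg_iff by blast
  next
    case (commutator V W)
    then show ?case unfolding HVF_alg_iff using hamiltonian_commutator by blast
  next
    case (add V W)
    then show ?case unfolding HVF_alg_iff using hamiltonian_add by blast
  next
    case (scale V c)
    then show ?case unfolding HVF_alg_iff using hamiltonian_scale by blast
  qed (use assms in blast)
qed

end


section \<open>Induction over Hamiltonian fields and flows\<close>

lemma complete_zero: "complete_vector_field M (\<lambda>_. 0)"
  unfolding complete_vector_field_def by (auto intro!: exI[of _ "\<lambda>_. p" for p])

context symplectic_variety
begin

text \<open>Induction over a Lie algebra with the density property, carried by pairs of a field and a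
  Hamiltonian function.  The function is only determined up to functions with Hamiltonian field zero;
  as the zero field is complete, these are covered by \<open>gen\<close>.\<close>

lemma density_induct [consumes 2, case_names gen add scale commutator]:
  assumes "algebraic_hamiltonian_density_property X \<omega>" and "hamiltonian X \<omega> a U"
    and gen: "\<And>a U. hamiltonian X \<omega> a U \<Longrightarrow> complete_vector_field X U \<Longrightarrow> R a U"
    and add: "\<And>a U b V. R a U \<Longrightarrow> R b V \<Longrightarrow> R (\<lambda>p. a p + b p) (\<lambda>p. U p + V p)"
    and scale: "\<And>c a U. R a U \<Longrightarrow> R (\<lambda>p. c * a p) (\<lambda>p. c *s U p)"
    and commutator: "\<And>a U b V. \<lbrakk>hamiltonian X \<omega> a U; hamiltonian X \<omega> b V; R a U; R b V\<rbrakk>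
      \<Longrightarrow> R (\<lambda>p. differential X b p (U p)) (commutator X U V)"
  shows "R a U"
proof -
  have "\<exists>b. hamiltonian X \<omega> b V \<and> R b V"
    if "V \<in> lie_generated X {V \<in> HVF_alg X \<omega>. complete_vector_field X V}" for V
    using that
  proof (induction rule: lie_generated.induct)
    case (gen V)
    then show ?case using assms(3) by (auto simp: HVF_alg_iff)
  next
    case zero
    show ?case using assms(3) hamiltonian_const complete_zero by blast
  next
    case (add V W)
    then show ?case using assms(4) hamiltonian_add by blast
  next
    case (scale V c)
    then show ?case using assms(5) hamiltonian_scale by blast
  next
    case (commutator V W)
    then show ?case using assms(6) hamiltonian_commutator by blast
  qed
  moreover have "U \<in> lie_generated X {V \<in> HVF_alg X \<omega>. complete_vector_field X V}"
    using assms(1,2) HVF_alg_iff unfolding algebraic_hamiltonian_density_property_def by blast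
  ultimately obtain b where b: "hamiltonian X \<omega> b U" "R b U" by blast
  have "hamiltonian X \<omega> (\<lambda>p. a p + (-1) * b p) (\<lambda>p. U p + (-1) *s U p)"
    using assms(2) b(1) hamiltonian_add hamiltonian_scale by blast
  then have "hamiltonian X \<omega> (\<lambda>p. a p - b p) (\<lambda>_. 0)"
    by (simp add: vector_sneg_minus1[symmetric])
  then have "R (\<lambda>p. (a p - b p) + b p) (\<lambda>p. 0 + U p)"
    using gen add b(2) complete_zero by blast
  then show ?thesis by simp
qed

text \<open>The derivative along the flow is \<open>da(U) = \<omega>(U,U) = 0\<close>.\<close>

lemma hamiltonian_const_along_flow:
  assumes "hamiltonian X \<omega> a U" "\<And>t. \<gamma> t \<in> X"
    and "\<And>t i. ((\<lambda>s. \<gamma> s $ i) has_field_derivative U (\<gamma> t) $ i) (at t)"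
  shows "a (\<gamma> t) = a (\<gamma> 0)"
proof -
  obtain F T where F: "poly_fun F" "\<And>q. q \<in> X \<Longrightarrow> a q = F q" "tangent_field X T"
    "\<And>q. q \<in> X \<Longrightarrow> U q = T q"
    "\<And>p w. p \<in> X \<Longrightarrow> w \<in> tangent_space X p \<Longrightarrow> \<omega> p (T p) w = D F p w"
    using assms(1) by (rule hamiltonianE) blast
  have "((\<lambda>s. F (\<gamma> s)) has_field_derivative 0) (at t)" for t
  proof -
    have "((\<lambda>s. F (\<gamma> s)) has_field_derivative D F (\<gamma> t) (U (\<gamma> t))) (at t)"
      using F(1) assms(3) by (rule poly_fun_along_curve)
    moreover have "D F (\<gamma> t) (U (\<gamma> t)) = 0"
      using F(3,4,5) assms(2)[of t] form_diag by (metis tangent_field_def)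
    ultimately show ?thesis by simp
  qed
  then obtain c where "\<forall>t. F (\<gamma> t) = c"
    using has_field_derivative_zero_constant[of UNIV "\<lambda>s. F (\<gamma> s)"] by auto
  then show ?thesis using F(2) assms(2) by simp
qed

end


section \<open>Products\<close>

definition pair :: "complex ^ 'n \<Rightarrow> complex ^ 'm \<Rightarrow> complex ^ ('n::finite + 'm::finite)" where
  "pair x y = (\<chi> k. case k of Inl i \<Rightarrow> x $ i | Inr j \<Rightarrow> y $ j)"

lemma pair_nth [simp]: "pair x y $ Inl i = x $ i" "pair x y $ Inr j = y $ j"
  by (simp_all add: pair_def)

lemma proj_nth [simp]: "proj_X z $ i = z $ Inl i" "proj_Y z $ j = z $ Inr j"
  by (simp_all add: proj_X_def proj_Y_def)

lemma vec_sum_eq_iff: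
  fixes z :: "'a ^ ('n::finite + 'm::finite)"
  shows "z = z' \<longleftrightarrow> (\<forall>i. z $ Inl i = z' $ Inl i) \<and> (\<forall>j. z $ Inr j = z' $ Inr j)"
  by (metis vec_eq_iff sum.exhaust)

lemma proj_pair [simp]: "proj_X (pair x y) = x" "proj_Y (pair x y) = y"
  by (simp_all add: vec_eq_iff)

lemma pair_proj [simp]: "pair (proj_X z) (proj_Y z) = z"
  by (simp add: vec_sum_eq_iff)

lemma proj_linear [simp]:
  "proj_X (v + w) = proj_X v + proj_X w" "proj_Y (v + w) = proj_Y v + proj_Y w"
  "proj_X (c *s v) = c *s proj_X v" "proj_Y (c *s v) = c *s proj_Y v"
  "proj_X 0 = 0" "proj_Y 0 = 0"
  by (simp_all add: vec_eq_iff)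

lemma pair_in_product [simp]: "pair x y \<in> product_variety X Y \<longleftrightarrow> x \<in> X \<and> y \<in> Y"
  by (simp add: product_variety_def)

lemma in_productD: "z \<in> product_variety X Y \<Longrightarrow> proj_X z \<in> X" "z \<in> product_variety X Y \<Longrightarrow> proj_Y z \<in> Y"
  by (simp_all add: product_variety_def)

lemma poly_fun_proj_X: "poly_fun F \<Longrightarrow> poly_fun (\<lambda>z. F (proj_X z))"
  by (induction rule: poly_fun.induct) (auto intro: poly_fun.intros)

lemma poly_fun_proj_Y: "poly_fun F \<Longrightarrow> poly_fun (\<lambda>z. F (proj_Y z))"
  by (induction rule: poly_fun.induct) (auto intro: poly_fun.intros)

lemma D_proj_X: "poly_fun F \<Longrightarrow> D (\<lambda>z. F (proj_X z)) z v = D F (proj_X z) (proj_X v)"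
  by (induction rule: poly_fun.induct) (simp_all add: D_simps poly_fun_proj_X)

lemma D_proj_Y: "poly_fun F \<Longrightarrow> D (\<lambda>z. F (proj_Y z)) z v = D F (proj_Y z) (proj_Y v)"
  by (induction rule: poly_fun.induct) (simp_all add: D_simps poly_fun_proj_Y)

lemma poly_fun_pair_left: "poly_fun F \<Longrightarrow> poly_fun (\<lambda>x. F (pair x y))"
proof (induction rule: poly_fun.induct)
  case (coord k)
  then show ?case by (cases k) (auto intro: poly_fun.intros)
qed (auto intro: poly_fun.intros)

lemma poly_fun_pair_right: "poly_fun F \<Longrightarrow> poly_fun (\<lambda>y. F (pair x y))"
proof (induction rule: poly_fun.induct)
  case (coord k)
  then show ?case by (cases k) (auto intro: poly_fun.intros)
qed (auto intro: poly_fun.intros)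

lemma D_pair_left: "poly_fun F \<Longrightarrow> D (\<lambda>x. F (pair x y)) x u = D F (pair x y) (pair u 0)"
proof (induction rule: poly_fun.induct)
  case (coord k)
  then show ?case by (cases k) (auto simp: D_simps)
qed (simp_all add: D_simps poly_fun_pair_left)

lemma D_pair_right: "poly_fun F \<Longrightarrow> D (\<lambda>y. F (pair x y)) y u = D F (pair x y) (pair 0 u)"
proof (induction rule: poly_fun.induct)
  case (coord k)
  then show ?case by (cases k) (auto simp: D_simps)
qed (simp_all add: D_simps poly_fun_pair_right)

text \<open>A polynomial vanishing on \<open>X \<times> Y\<close> vanishes on \<open>X\<close> when \<open>y \<in> Y\<close> is fixed, and on \<open>Y\<close> when
  \<open>x \<in> X\<close> is fixed; conversely the ideals of \<open>X\<close> and \<open>Y\<close> pull back into the ideal of the product.\<close>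

lemma tangent_space_product:
  assumes z: "z \<in> product_variety X Y"
  shows "v \<in> tangent_space (product_variety X Y) z \<longleftrightarrow>
    proj_X v \<in> tangent_space X (proj_X z) \<and> proj_Y v \<in> tangent_space Y (proj_Y z)" (is "?L \<longleftrightarrow> ?R")
proof
  assume L: ?L
  show ?R
    unfolding tangent_space_def
  proof safe
    fix F assume F: "F \<in> vanishing_ideal X"
    then have "(\<lambda>z. F (proj_X z)) \<in> vanishing_ideal (product_variety X Y)"
      by (auto simp: vanishing_ideal_def poly_fun_proj_X in_productD)
    then have "D (\<lambda>z. F (proj_X z)) z v = 0" using L by (rule D_vanishing)
    then show "D F (proj_X z) (proj_X v) = 0" using F by (simp add: D_proj_X vanishing_ideal_def)
  next
    fix F assume F: "F \<in> vanishing_ideal Y"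
    then have "(\<lambda>z. F (proj_Y z)) \<in> vanishing_ideal (product_variety X Y)"
      by (auto simp: vanishing_ideal_def poly_fun_proj_Y in_productD)
    then have "D (\<lambda>z. F (proj_Y z)) z v = 0" using L by (rule D_vanishing)
    then show "D F (proj_Y z) (proj_Y v) = 0" using F by (simp add: D_proj_Y vanishing_ideal_def)
  qed
next
  assume R: ?R
  show ?L
    unfolding tangent_space_def
  proof safe
    fix F assume F: "F \<in> vanishing_ideal (product_variety X Y)"
    then have pf: "poly_fun F" by (simp add: vanishing_ideal_def)
    have "(\<lambda>x. F (pair x (proj_Y z))) \<in> vanishing_ideal X"
      "(\<lambda>y. F (pair (proj_X z) y)) \<in> vanishing_ideal Y"
      using F z by (auto simp: vanishing_ideal_def poly_fun_pair_left poly_fun_pair_right in_productD)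
    then have "D F z (pair (proj_X v) 0) = 0" "D F z (pair 0 (proj_Y v)) = 0"
      using R D_vanishing D_pair_left[OF pf, of "proj_Y z" "proj_X z"]
        D_pair_right[OF pf, of "proj_X z" "proj_Y z"] by fastforce+
    moreover have "pair (proj_X v) 0 + pair 0 (proj_Y v) = v"
      by (simp add: vec_sum_eq_iff)
    ultimately show "D F z v = 0"
      using D_vadd[OF pf, of z "pair (proj_X v) 0" "pair 0 (proj_Y v)"] by simp
  qed
qed

lemma sum_UNIV_sum:
  "(\<Sum>k\<in>UNIV. h k) = (\<Sum>i\<in>UNIV. h (Inl i)) + (\<Sum>j\<in>UNIV. h (Inr j))"
  for h :: "'n::finite + 'm::finite \<Rightarrow> complex"
  by (simp add: UNIV_Plus_UNIV[symmetric] sum.Plus del: UNIV_Plus_UNIV)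

definition block_matrix ::
    "('n \<Rightarrow> 'n \<Rightarrow> complex ^ 'n \<Rightarrow> complex) \<Rightarrow> ('m \<Rightarrow> 'm \<Rightarrow> complex ^ 'm \<Rightarrow> complex) \<Rightarrow>
      'n::finite + 'm::finite \<Rightarrow> 'n + 'm \<Rightarrow> complex ^ ('n + 'm) \<Rightarrow> complex" where
  "block_matrix A B k l z = (case (k, l) of
      (Inl i, Inl i') \<Rightarrow> A i i' (proj_X z)
    | (Inr j, Inr j') \<Rightarrow> B j j' (proj_Y z)
    | _ \<Rightarrow> 0)"

lemma block_matrix_simps [simp]:
  "block_matrix A B (Inl i) (Inl i') = (\<lambda>z. A i i' (proj_X z))"
  "block_matrix A B (Inr j) (Inr j') = (\<lambda>z. B j j' (proj_Y z))"
  "block_matrix A B (Inl i) (Inr j) = (\<lambda>z. 0)"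
  "block_matrix A B (Inr j) (Inl i) = (\<lambda>z. 0)"
  by (simp_all add: block_matrix_def fun_eq_iff)

lemma form_of_block_matrix:
  "form_of (block_matrix A B) z v w =
    form_of A (proj_X z) (proj_X v) (proj_X w) + form_of B (proj_Y z) (proj_Y v) (proj_Y w)"
  by (simp add: form_of_def sum_UNIV_sum)

lemma exterior_deriv_block_matrix:
  assumes "\<And>i j. poly_fun (A i j)" "\<And>i j. poly_fun (B i j)"
  shows "exterior_deriv (block_matrix A B) z u v w =
    exterior_deriv A (proj_X z) (proj_X u) (proj_X v) (proj_X w) +
    exterior_deriv B (proj_Y z) (proj_Y u) (proj_Y v) (proj_Y w)"
  by (simp add: exterior_deriv_def sum_UNIV_sum D_proj_X D_proj_Y assms D_const)

lemma product_form_eq: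
  "product_form \<omega>X \<omega>Y z v w =
    \<omega>X (proj_X z) (proj_X v) (proj_X w) + \<omega>Y (proj_Y z) (proj_Y v) (proj_Y w)"
proof -
  have 1: "linear (proj_X :: complex ^ ('a + 'b) \<Rightarrow> _)" "linear (proj_Y :: complex ^ ('a + 'b) \<Rightarrow> _)"
    by (auto intro!: linearI simp: vec_eq_iff)
  have "frechet_derivative proj_X (at z) = proj_X" "frechet_derivative proj_Y (at z) = proj_Y"
    using 1 by (metis linear_imp_has_derivative frechet_derivative_at)+
  then show ?thesis by (simp add: product_form_def pullback_form_def)
qed

lemma tangent_field_pair:
  fixes X :: "(complex ^ 'n) set" and Y :: "(complex ^ 'm) set"
  assumes "tangent_field X U" "tangent_field Y W" "poly_fun a" "poly_fun b"
  shows "tangent_field (product_variety X Y) (\<lambda>z. pair (a z *s U (proj_X z)) (b z *s W (proj_Y z)))"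
proof -
  have pf: "poly_fun (\<lambda>z :: complex ^ ('n + 'm). U (proj_X z) $ i)"
    "poly_fun (\<lambda>z :: complex ^ ('n + 'm). W (proj_Y z) $ j)" for i j
    using assms poly_fun_proj_X[of "\<lambda>x. U x $ i"] poly_fun_proj_Y[of "\<lambda>y. W y $ j"]
    by (auto simp: tangent_field_def poly_field_def)
  have "poly_fun (\<lambda>z. pair (a z *s U (proj_X z)) (b z *s W (proj_Y z)) $ k)" for k
    using pf assms(3,4) by (cases k) (simp_all add: poly_fun.mult)
  then have "poly_field (\<lambda>z. pair (a z *s U (proj_X z)) (b z *s W (proj_Y z)))"
    by (simp add: poly_field_def)
  then show ?thesis
    using assms(1,2)
    by (auto simp: tangent_field_def tangent_space_product in_productD tangent_scale)
qed

locale symplectic_pair =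
  X: symplectic_variety X \<omega>X A + Y: symplectic_variety Y \<omega>Y B
  for X :: "(complex ^ 'n) set" and \<omega>X A and Y :: "(complex ^ 'm) set" and \<omega>Y B
begin

abbreviation Z :: "(complex ^ ('n + 'm)) set" where "Z \<equiv> product_variety X Y"
abbreviation \<omega>Z :: "complex ^ ('n + 'm) \<Rightarrow> complex ^ ('n + 'm) \<Rightarrow> complex ^ ('n + 'm) \<Rightarrow> complex"
  where "\<omega>Z \<equiv> product_form \<omega>X \<omega>Y"

lemma product_form_left:
  assumes "z \<in> Z" "v \<in> tangent_space Z z"
  shows "\<omega>Z z v (pair u 0) = \<omega>X (proj_X z) (proj_X v) u"
  using assms by (simp add: product_form_eq tangent_space_product in_productD Y.form_zero_right)

lemma product_form_right:
  assumes "z \<in> Z" "v \<in> tangent_space Z z"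
  shows "\<omega>Z z v (pair 0 u) = \<omega>Y (proj_Y z) (proj_Y v) u"
  using assms by (simp add: product_form_eq tangent_space_product in_productD X.form_zero_right)

sublocale Z: symplectic_variety Z \<omega>Z "block_matrix A B"
proof
  show "form_coefficients Z \<omega>Z (block_matrix A B)"
    unfolding form_coefficients_def
  proof (intro conjI allI ballI)
    fix k l z
    show "poly_fun (block_matrix A B k l)"
      by (cases k; cases l)
        (auto simp: X.A_poly Y.A_poly poly_fun_proj_X poly_fun_proj_Y poly_fun.const)
    show "block_matrix A B k l z = - block_matrix A B l k z"
      by (cases k; cases l) (auto intro: X.A_skew Y.A_skew)
  next
    fix z v w assume "z \<in> Z" "v \<in> tangent_space Z z" "w \<in> tangent_space Z z"
    then show "\<omega>Z z v w = (\<Sum>i\<in>UNIV. \<Sum>j\<in>UNIV. block_matrix A B i j z * v $ i * w $ j)"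
      using form_of_block_matrix[of A B z v w]
      by (simp add: form_of_def[of "block_matrix A B"] product_form_eq tangent_space_product
          in_productD X.form_eq Y.form_eq)
  qed
  show "exterior_deriv (block_matrix A B) z u v w = 0"
    if "z \<in> Z" "u \<in> tangent_space Z z" "v \<in> tangent_space Z z" "w \<in> tangent_space Z z" for z u v w
    using that
    by (simp add: exterior_deriv_block_matrix X.A_poly Y.A_poly tangent_space_product in_productD
        X.closed Y.closed)
  show "nondegenerate_form Z \<omega>Z"
    unfolding nondegenerate_form_def
  proof (intro ballI impI)
    fix z v assume z: "z \<in> Z" and v: "v \<in> tangent_space Z z"
      and 0: "\<forall>w\<in>tangent_space Z z. \<omega>Z z v w = 0"
    have "\<omega>X (proj_X z) (proj_X v) u = 0" if "u \<in> tangent_space X (proj_X z)" for u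
      using 0 product_form_left[OF z v, of u] that z
      by (auto simp: tangent_space_product tangent_zero)
    moreover have "\<omega>Y (proj_Y z) (proj_Y v) u = 0" if "u \<in> tangent_space Y (proj_Y z)" for u
      using 0 product_form_right[OF z v, of u] that z
      by (auto simp: tangent_space_product tangent_zero)
    ultimately have "proj_X v = 0" "proj_Y v = 0"
      using X.nondegenerate[unfolded nondegenerate_form_def, rule_format, of "proj_X z" "proj_X v"]
        Y.nondegenerate[unfolded nondegenerate_form_def, rule_format, of "proj_Y z" "proj_Y v"] z v
      by (simp_all add: tangent_space_product in_productD)
    then show "v = 0" by (simp add: vec_sum_eq_iff vec_eq_iff)
  qed
  show "\<exists>U. tangent_field Z U \<and> U z = u" if zu: "z \<in> Z" "u \<in> tangent_space Z z" for z u
  proof -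
    obtain V where "tangent_field X V" "V (proj_X z) = proj_X u"
      using X.extend_tangent[of "proj_X z" "proj_X u"] zu
      by (auto simp: tangent_space_product in_productD)
    moreover obtain W where "tangent_field Y W" "W (proj_Y z) = proj_Y u"
      using Y.extend_tangent[of "proj_Y z" "proj_Y u"] zu
      by (auto simp: tangent_space_product in_productD)
    ultimately show ?thesis
      using tangent_field_pair[of X V Y W "\<lambda>_. 1" "\<lambda>_. 1"]
      by (intro exI[of _ "\<lambda>z. pair (1 *s V (proj_X z)) (1 *s W (proj_Y z))"])
        (simp add: poly_fun.const)
  qed
qed

text \<open>For Hamiltonian fields \<open>U\<close> of \<open>a\<close> and \<open>W\<close> of \<open>b\<close>, this is the Hamiltonian field of \<open>a(x) b(y)\<close>.\<close>

definition product_field :: "(complex ^ 'n \<Rightarrow> complex) \<Rightarrow> (complex ^ 'n \<Rightarrow> complex ^ 'n) \<Rightarrow>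
    (complex ^ 'm \<Rightarrow> complex) \<Rightarrow> (complex ^ 'm \<Rightarrow> complex ^ 'm) \<Rightarrow>
    complex ^ ('n + 'm) \<Rightarrow> complex ^ ('n + 'm)" where
  "product_field a U b W = restrict_field Z
    (\<lambda>z. pair (b (proj_Y z) *s U (proj_X z)) (a (proj_X z) *s W (proj_Y z)))"

lemma hamiltonian_product_field:
  assumes "hamiltonian X \<omega>X a U" "hamiltonian Y \<omega>Y b W"
  shows "hamiltonian Z \<omega>Z (\<lambda>z. a (proj_X z) * b (proj_Y z)) (product_field a U b W)"
proof -
  obtain F T where F: "poly_fun F" "\<And>q. q \<in> X \<Longrightarrow> a q = F q" "tangent_field X T"
    "\<And>q. q \<in> X \<Longrightarrow> U q = T q"
    "\<And>p w. p \<in> X \<Longrightarrow> w \<in> tangent_space X p \<Longrightarrow> \<omega>X p (T p) w = D F p w"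
    using assms(1) by (rule hamiltonianE) blast
  obtain G S where G: "poly_fun G" "\<And>q. q \<in> Y \<Longrightarrow> b q = G q" "tangent_field Y S"
    "\<And>q. q \<in> Y \<Longrightarrow> W q = S q"
    "\<And>p w. p \<in> Y \<Longrightarrow> w \<in> tangent_space Y p \<Longrightarrow> \<omega>Y p (S p) w = D G p w"
    using assms(2) by (rule hamiltonianE) blast
  let ?V = "\<lambda>z. pair (G (proj_Y z) *s T (proj_X z)) (F (proj_X z) *s S (proj_Y z))"
  show ?thesis
  proof (rule hamiltonianI[of "\<lambda>z. F (proj_X z) * G (proj_Y z)" _ _ ?V])
    show "poly_fun (\<lambda>z. F (proj_X z) * G (proj_Y z))"
      using F(1) G(1) by (intro poly_fun.mult poly_fun_proj_X poly_fun_proj_Y)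
    show "tangent_field Z ?V"
      using F(1,3) G(1,3) by (intro tangent_field_pair poly_fun_proj_X poly_fun_proj_Y)
    show "\<omega>Z z (?V z) w = D (\<lambda>z. F (proj_X z) * G (proj_Y z)) z w"
      if z: "z \<in> Z" and w: "w \<in> tangent_space Z z" for z w
      using F(1,3,5) G(1,3,5) that
      by (simp add: product_form_eq D_mult poly_fun_proj_X poly_fun_proj_Y D_proj_X D_proj_Y
          X.form_scale_left Y.form_scale_left tangent_field_def tangent_space_product in_productD)
  qed (use F(2,4) G(2,4) in \<open>auto simp: product_field_def restrict_field_def in_productD\<close>)
qed

text \<open>As \<open>a\<close> is constant along the flow of \<open>U\<close> and \<open>b\<close> along the flow of \<open>W\<close>, the flow of the product field
  runs through both flows, at the constant speeds \<open>b\<close> and \<open>a\<close>.\<close>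

lemma complete_product_field:
  assumes U: "hamiltonian X \<omega>X a U" "complete_vector_field X U"
    and W: "hamiltonian Y \<omega>Y b W" "complete_vector_field Y W"
  shows "complete_vector_field Z (product_field a U b W)"
  unfolding complete_vector_field_def
proof
  fix z assume z: "z \<in> Z"
  obtain \<phi> where \<phi>: "\<phi> 0 = proj_X z" "\<And>t. \<phi> t \<in> X"
    "\<And>t i. ((\<lambda>s. \<phi> s $ i) has_field_derivative U (\<phi> t) $ i) (at t)"
    using U(2) in_productD(1)[OF z] unfolding complete_vector_field_def by blast
  obtain \<psi> where \<psi>: "\<psi> 0 = proj_Y z" "\<And>t. \<psi> t \<in> Y"
    "\<And>t i. ((\<lambda>s. \<psi> s $ i) has_field_derivative W (\<psi> t) $ i) (at t)"
    using W(2) in_productD(2)[OF z] unfolding complete_vector_field_def by blast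
  have a: "a (\<phi> t) = a (proj_X z)" for t
    using X.hamiltonian_const_along_flow[OF U(1) \<phi>(2,3)] \<phi>(1) by simp
  have b: "b (\<psi> t) = b (proj_Y z)" for t
    using Y.hamiltonian_const_along_flow[OF W(1) \<psi>(2,3)] \<psi>(1) by simp
  let ?\<gamma> = "\<lambda>t. pair (\<phi> (b (proj_Y z) * t)) (\<psi> (a (proj_X z) * t))"
  have "((\<lambda>s. ?\<gamma> s $ k) has_field_derivative product_field a U b W (?\<gamma> t) $ k) (at t)" for t k
  proof (cases k)
    case (Inl i)
    have "((\<lambda>s. \<phi> (b (proj_Y z) * s) $ i) has_field_derivative
        U (\<phi> (b (proj_Y z) * t)) $ i * b (proj_Y z)) (at t)"
      by (rule DERIV_chain2[where f = "\<lambda>s. \<phi> s $ i", OF \<phi>(3) DERIV_cmult_Id])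
    then show ?thesis
      by (simp add: Inl product_field_def restrict_field_def \<phi>(2) \<psi>(2) b mult.commute)
  next
    case (Inr j)
    have "((\<lambda>s. \<psi> (a (proj_X z) * s) $ j) has_field_derivative
        W (\<psi> (a (proj_X z) * t)) $ j * a (proj_X z)) (at t)"
      by (rule DERIV_chain2[where f = "\<lambda>s. \<psi> s $ j", OF \<psi>(3) DERIV_cmult_Id])
    then show ?thesis
      by (simp add: Inr product_field_def restrict_field_def \<phi>(2) \<psi>(2) a mult.commute)
  qed
  then show "\<exists>\<gamma>. \<gamma> 0 = z \<and> (\<forall>t. \<gamma> t \<in> Z) \<and>
      (\<forall>t i. ((\<lambda>s. \<gamma> s $ i) has_field_derivative product_field a U b W (\<gamma> t) $ i) (at t))"
    using \<phi>(1,2) \<psi>(1,2) by (intro exI[of _ ?\<gamma>]) simp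
qed

text \<open>Bracketing with the lift of \<open>U\<close>, the product field with \<open>b = 1\<close>, acts on the first factor alone.  Both
  sides have the Hamiltonian function \<open>U(a')(x) b(y)\<close>.\<close>

lemma commutator_product_field_left:
  assumes "hamiltonian X \<omega>X a U" "hamiltonian X \<omega>X a' U'" "hamiltonian Y \<omega>Y b W"
  shows "commutator Z (product_field a U (\<lambda>_. 1) (\<lambda>_. 0)) (product_field a' U' b W) =
    product_field (\<lambda>x. differential X a' x (U x)) (commutator X U U') b W" (is "?L = ?R")
proof -
  let ?P = "product_field a U (\<lambda>_. 1) (\<lambda>_. 0)"
  obtain T where T: "tangent_field X T" "\<And>q. q \<in> X \<Longrightarrow> U q = T q"
    using assms(1) by (rule hamiltonianE) blast
  obtain F where F: "poly_fun F" "\<And>q. q \<in> X \<Longrightarrow> a' q = F q"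
    using assms(2) by (rule hamiltonianE) blast
  obtain G where G: "poly_fun G" "\<And>q. q \<in> Y \<Longrightarrow> b q = G q"
    using assms(3) by (rule hamiltonianE) blast
  have "hamiltonian Z \<omega>Z (\<lambda>z. differential Z (\<lambda>z. a' (proj_X z) * b (proj_Y z)) z (?P z)) ?L"
    using Z.hamiltonian_commutator[OF hamiltonian_product_field[OF assms(1) Y.hamiltonian_const]
      hamiltonian_product_field[OF assms(2,3)]] .
  moreover have "differential Z (\<lambda>z. a' (proj_X z) * b (proj_Y z)) z (?P z) =
      differential X a' (proj_X z) (U (proj_X z)) * b (proj_Y z)" if z: "z \<in> Z" for z
  proof -
    note x = in_productD(1)[OF z] and y = in_productD(2)[OF z]
    have P: "?P z = pair (T (proj_X z)) 0"
      using z x T by (simp add: product_field_def restrict_field_def vec_sum_eq_iff)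
    have "differential Z (\<lambda>z. a' (proj_X z) * b (proj_Y z)) z (?P z) =
        D (\<lambda>z. F (proj_X z) * G (proj_Y z)) z (?P z)"
      using F G T x y z
      by (intro differential_eq)
        (auto simp: poly_fun.mult poly_fun_proj_X poly_fun_proj_Y in_productD P tangent_space_product
          tangent_zero tangent_field_def)
    also have "\<dots> = D F (proj_X z) (T (proj_X z)) * G (proj_Y z)"
      using F G
      by (simp add: P D_mult poly_fun_proj_X poly_fun_proj_Y D_proj_X D_proj_Y D_vzero)
    also have "D F (proj_X z) (T (proj_X z)) = differential X a' (proj_X z) (T (proj_X z))"
      using F T x by (intro differential_eq[symmetric]) (auto simp: tangent_field_def)
    finally show ?thesis using G y T x by simp
  qed
  ultimately have "hamiltonian Z \<omega>Z
      (\<lambda>z. differential X a' (proj_X z) (U (proj_X z)) * b (proj_Y z)) ?L"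
    by (rule hamiltonian_cong)
  moreover have "hamiltonian Z \<omega>Z
      (\<lambda>z. differential X a' (proj_X z) (U (proj_X z)) * b (proj_Y z)) ?R"
    using hamiltonian_product_field[OF X.hamiltonian_commutator[OF assms(1,2)] assms(3)] .
  ultimately show ?thesis by (rule Z.hamiltonian_unique)
qed

lemma commutator_product_field_right:
  assumes "hamiltonian Y \<omega>Y b W" "hamiltonian Y \<omega>Y b' W'" "hamiltonian X \<omega>X a U"
  shows "commutator Z (product_field (\<lambda>_. 1) (\<lambda>_. 0) b W) (product_field a U b' W') =
    product_field a U (\<lambda>y. differential Y b' y (W y)) (commutator Y W W')" (is "?L = ?R")
proof -
  let ?P = "product_field (\<lambda>_. 1) (\<lambda>_. 0) b W"
  obtain T where T: "tangent_field Y T" "\<And>q. q \<in> Y \<Longrightarrow> W q = T q"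
    using assms(1) by (rule hamiltonianE) blast
  obtain G where G: "poly_fun G" "\<And>q. q \<in> Y \<Longrightarrow> b' q = G q"
    using assms(2) by (rule hamiltonianE) blast
  obtain F where F: "poly_fun F" "\<And>q. q \<in> X \<Longrightarrow> a q = F q"
    using assms(3) by (rule hamiltonianE) blast
  have "hamiltonian Z \<omega>Z (\<lambda>z. differential Z (\<lambda>z. a (proj_X z) * b' (proj_Y z)) z (?P z)) ?L"
    using Z.hamiltonian_commutator[OF hamiltonian_product_field[OF X.hamiltonian_const assms(1)]
      hamiltonian_product_field[OF assms(3,2)]] .
  moreover have "differential Z (\<lambda>z. a (proj_X z) * b' (proj_Y z)) z (?P z) =
      a (proj_X z) * differential Y b' (proj_Y z) (W (proj_Y z))" if z: "z \<in> Z" for z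
  proof -
    note x = in_productD(1)[OF z] and y = in_productD(2)[OF z]
    have P: "?P z = pair 0 (T (proj_Y z))"
      using z y T by (simp add: product_field_def restrict_field_def vec_sum_eq_iff)
    have "differential Z (\<lambda>z. a (proj_X z) * b' (proj_Y z)) z (?P z) =
        D (\<lambda>z. F (proj_X z) * G (proj_Y z)) z (?P z)"
      using F G T x y z
      by (intro differential_eq)
        (auto simp: poly_fun.mult poly_fun_proj_X poly_fun_proj_Y in_productD P tangent_space_product
          tangent_zero tangent_field_def)
    also have "\<dots> = F (proj_X z) * D G (proj_Y z) (T (proj_Y z))"
      using F G
      by (simp add: P D_mult poly_fun_proj_X poly_fun_proj_Y D_proj_X D_proj_Y D_vzero)
    also have "D G (proj_Y z) (T (proj_Y z)) = differential Y b' (proj_Y z) (T (proj_Y z))"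
      using G T y by (intro differential_eq[symmetric]) (auto simp: tangent_field_def)
    finally show ?thesis using F y T x by simp
  qed
  ultimately have "hamiltonian Z \<omega>Z
      (\<lambda>z. a (proj_X z) * differential Y b' (proj_Y z) (W (proj_Y z))) ?L"
    by (rule hamiltonian_cong)
  moreover have "hamiltonian Z \<omega>Z
      (\<lambda>z. a (proj_X z) * differential Y b' (proj_Y z) (W (proj_Y z))) ?R"
    using hamiltonian_product_field[OF assms(3) Y.hamiltonian_commutator[OF assms(1,2)]] .
  ultimately show ?thesis by (rule Z.hamiltonian_unique)
qed

end


section \<open>Separation of variables\<close>

definition function_space :: "(('a \<Rightarrow> complex) \<Rightarrow> bool) \<Rightarrow> bool" where
  "function_space S \<longleftrightarrow>
    (\<forall>a b. S a \<longrightarrow> S b \<longrightarrow> S (\<lambda>x. a x + b x)) \<and> (\<forall>c a. S a \<longrightarrow> S (\<lambda>x. c * a x))"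

definition tensor :: "(('a \<Rightarrow> complex) \<times> ('b \<Rightarrow> complex)) list \<Rightarrow> 'a \<Rightarrow> 'b \<Rightarrow> complex" where
  "tensor ps x y = (\<Sum>(a, b)\<leftarrow>ps. a x * b y)"

lemma tensor_simps [simp]:
  "tensor [] x y = 0" "tensor ((a, b) # ps) x y = a x * b y + tensor ps x y"
  "tensor (ps @ qs) x y = tensor ps x y + tensor qs x y"
  by (simp_all add: tensor_def)

lemma tensor_swap: "tensor (map prod.swap ps) y x = tensor ps x y"
  by (induction ps) (auto simp: mult.commute)

text \<open>Elimination.  Where a second factor \<open>b\<close> is nonzero at some \<open>y\<^sub>0\<close>, the slice \<open>F(\<cdot>,y\<^sub>0)\<close> can take the
  place of the first factor \<open>a\<close>, and the remaining terms decompose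
  \<open>F(x,y) - F(x,y\<^sub>0) b(y) / b(y\<^sub>0)\<close>, which has its slices in \<open>S\<close> again.\<close>

lemma tensor_first_factors:
  assumes S: "function_space S" and T: "function_space T"
    and "\<forall>(a, b)\<in>set ps. T b"
    and "\<And>x y. x \<in> X \<Longrightarrow> y \<in> Y \<Longrightarrow> F x y = tensor ps x y"
    and "\<And>y. y \<in> Y \<Longrightarrow> S (\<lambda>x. F x y)"
  shows "\<exists>qs. (\<forall>(a, b)\<in>set qs. S a \<and> T b) \<and> (\<forall>x\<in>X. \<forall>y\<in>Y. F x y = tensor qs x y)"
  using assms(3-)
proof (induction "length ps" arbitrary: ps F)
  case 0
  then show ?case by (intro exI[of _ "[]"]) simp
next
  case (Suc r)
  then obtain a b ps' where ps: "ps = (a, b) # ps'" by (metis Suc_length_conv surj_pair)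
  show ?case
  proof (cases "\<exists>y0\<in>Y. b y0 \<noteq> 0")
    case False
    show ?thesis
      using Suc.prems Suc.hyps(2) False by (intro Suc.hyps(1)[of ps']) (auto simp: ps)
  next
    case True
    then obtain y0 where y0: "y0 \<in> Y" "b y0 \<noteq> 0" by blast
    define b0 where "b0 = (\<lambda>y. 1 / b y0 * b y)"
    define G where "G x y = F x y + (- b0 y) * F x y0" for x y
    define qs where "qs = map (\<lambda>(c, d). (c, \<lambda>y. d y + (- d y0) * b0 y)) ps'"
    have "T b" using Suc.prems(1) by (simp add: ps)
    then have T_b0: "T b0" using T unfolding b0_def function_space_def by blast
    have "tensor (map (\<lambda>(c, d). (c, \<lambda>y. d y + (- d y0) * b0 y)) rs) x y =
        tensor rs x y - tensor rs x y0 * b0 y" for rs :: "(('a \<Rightarrow> complex) \<times> ('b \<Rightarrow> complex)) list" and x y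
      by (induction rs) (auto simp: algebra_simps)
    then have "G x y = tensor qs x y" if "x \<in> X" "y \<in> Y" for x y
      using that y0 Suc.prems(2) by (simp add: qs_def G_def ps algebra_simps) (simp add: b0_def)
    moreover have "T (\<lambda>y. d y + (- d y0) * b0 y)" if "T d" for d
      using that T T_b0 unfolding function_space_def by blast
    then have "\<forall>(c, d)\<in>set qs. T d"
      using Suc.prems(1) unfolding qs_def ps by auto
    moreover have "S (\<lambda>x. G x y)" if "y \<in> Y" for y
      using Suc.prems(3) y0(1) that S unfolding G_def function_space_def by blast
    moreover have "r = length qs" using Suc.hyps(2) by (simp add: qs_def ps)
    ultimately obtain qs' where qs': "\<forall>(a, b)\<in>set qs'. S a \<and> T b"
      "\<forall>x\<in>X. \<forall>y\<in>Y. G x y = tensor qs' x y"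
      using Suc.hyps(1)[of qs G] by blast
    have "F x y = tensor ((\<lambda>x. F x y0, b0) # qs') x y" if "x \<in> X" "y \<in> Y" for x y
      using qs'(2) that by (simp add: G_def) (metis add.commute diff_add_cancel mult.commute)
    moreover have "\<forall>(a, b)\<in>set ((\<lambda>x. F x y0, b0) # qs'). S a \<and> T b"
      using qs'(1) T_b0 Suc.prems(3)[OF y0(1)] by auto
    ultimately show ?thesis by blast
  qed
qed

text \<open>The second factors are moved into \<open>T\<close> first, with no condition on the first ones; the lemma above then
  moves the first factors into \<open>S\<close> and leaves the second ones in \<open>T\<close>.\<close>

lemma tensor_both_factors:
  assumes S: "function_space S" and T: "function_space T"
    and F: "\<And>x y. x \<in> X \<Longrightarrow> y \<in> Y \<Longrightarrow> F x y = tensor ps x y"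
    and slices: "\<And>y. y \<in> Y \<Longrightarrow> S (\<lambda>x. F x y)" "\<And>x. x \<in> X \<Longrightarrow> T (\<lambda>y. F x y)"
  shows "\<exists>qs. (\<forall>(a, b)\<in>set qs. S a \<and> T b) \<and> (\<forall>x\<in>X. \<forall>y\<in>Y. F x y = tensor qs x y)"
proof -
  have "\<exists>rs. (\<forall>(b, a)\<in>set rs. T b \<and> True) \<and> (\<forall>y\<in>Y. \<forall>x\<in>X. F x y = tensor rs y x)"
    using T F slices(2)
    by (intro tensor_first_factors[where ps = "map prod.swap ps"])
      (auto simp: function_space_def tensor_swap)
  then obtain rs where rs: "\<forall>(b, a)\<in>set rs. T b" "\<forall>y\<in>Y. \<forall>x\<in>X. F x y = tensor rs y x"
    by auto
  show ?thesis
    using rs slices(1)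
    by (intro tensor_first_factors[OF S T, where ps = "map prod.swap rs"])
      (auto simp: tensor_swap)
qed

lemma poly_fun_tensor:
  fixes F :: "complex ^ ('n::finite + 'm::finite) \<Rightarrow> complex"
  assumes "poly_fun F"
  shows "\<exists>ps. \<forall>x y. F (pair x y) = tensor ps x y"
  using assms
proof (induction rule: poly_fun.induct)
  case (const c)
  show ?case by (intro exI[of _ "[(\<lambda>_. c, \<lambda>_. 1)]"]) simp
next
  case (coord k)
  show ?case
  proof (cases k)
    case (Inl i)
    then show ?thesis by (intro exI[of _ "[(\<lambda>x. x $ i, \<lambda>_. 1)]"]) simp
  next
    case (Inr j)
    then show ?thesis by (intro exI[of _ "[(\<lambda>_. 1, \<lambda>y. y $ j)]"]) simp
  qed
next
  case (add F G)
  then show ?case by (metis tensor_simps(3))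
next
  case (mult F G)
  obtain ps qs where ps: "\<And>x y. F (pair x y) = tensor ps x y"
    and qs: "\<And>x y. G (pair x y) = tensor qs x y"
    using mult.IH by blast
  have 1: "tensor (map (\<lambda>(c, d). (\<lambda>x. a x * c x, \<lambda>y. b y * d y)) rs) x y = a x * b y * tensor rs x y"
    for rs a b and x :: "complex ^ 'n" and y :: "complex ^ 'm"
    by (induction rs) (auto simp: algebra_simps)
  have "\<exists>rs. \<forall>x y. tensor ps x y * tensor qs x y = tensor rs x y" for ps
  proof (induction ps)
    case Nil
    show ?case by (intro exI[of _ "[]"]) simp
  next
    case (Cons p ps)
    obtain a b where p: "p = (a, b)" by fastforce
    obtain rs where rs: "\<And>x y. tensor ps x y * tensor qs x y = tensor rs x y"
      using Cons.IH by blast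
    show ?case
      by (intro exI[of _ "map (\<lambda>(c, d). (\<lambda>x. a x * c x, \<lambda>y. b y * d y)) qs @ rs"])
        (simp add: p 1 rs distrib_right)
  qed
  then show ?case by (simp add: ps qs)
qed


section \<open>The density property of products\<close>

context symplectic_pair
begin

abbreviation L :: "(complex ^ ('n + 'm) \<Rightarrow> complex ^ ('n + 'm)) set" where
  "L \<equiv> lie_generated Z {V \<in> HVF_alg Z \<omega>Z. complete_vector_field Z V}"

lemma product_field_add_left:
  "product_field (\<lambda>x. a x + a' x) (\<lambda>x. U x + U' x) b W =
    (\<lambda>z. product_field a U b W z + product_field a' U' b W z)"
  and product_field_scale_left:
  "product_field (\<lambda>x. c * a x) (\<lambda>x. c *s U x) b W = (\<lambda>z. c *s product_field a U b W z)"
  by (auto simp: product_field_def restrict_field_def fun_eq_iff vec_sum_eq_iff algebra_simps)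

lemma product_field_add_right:
  "product_field a U (\<lambda>y. b y + b' y) (\<lambda>y. W y + W' y) =
    (\<lambda>z. product_field a U b W z + product_field a U b' W' z)"
  and product_field_scale_right:
  "product_field a U (\<lambda>y. c * b y) (\<lambda>y. c *s W y) = (\<lambda>z. c *s product_field a U b W z)"
  by (auto simp: product_field_def restrict_field_def fun_eq_iff vec_sum_eq_iff algebra_simps)

text \<open>The pairs \<open>(a,U)\<close> whose product fields with all complete \<open>(b,W)\<close> are in \<open>L\<close> include the complete ones and are
  stable under brackets: the lift of the other member of the bracket is itself such a product field, the
  one for \<open>b = 1\<close> and \<open>W = 0\<close>.  The density property of \<open>X\<close> gives all pairs.\<close>

lemma product_field_complete_right:
  assumes "algebraic_hamiltonian_density_property X \<omega>X" "hamiltonian X \<omega>X a U"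
    and "hamiltonian Y \<omega>Y b W" "complete_vector_field Y W"
  shows "product_field a U b W \<in> L"
proof -
  have "\<forall>b W. hamiltonian Y \<omega>Y b W \<and> complete_vector_field Y W \<longrightarrow> product_field a U b W \<in> L"
    using assms(1,2)
  proof (induction rule: X.density_induct)
    case (gen a U)
    have "product_field a U b W \<in> HVF_alg Z \<omega>Z" if "hamiltonian Y \<omega>Y b W" for b W
      using hamiltonian_product_field[OF gen(1) that] HVF_alg_iff by blast
    then show ?case
      using complete_product_field[OF gen] by (blast intro: lie_generated.gen)
  next
    case (commutator a U a' U')
    have "product_field a U (\<lambda>_. 1) (\<lambda>_. 0) \<in> L"
      using commutator(3) Y.hamiltonian_const complete_zero by blast
    then show ?case
      using commutator(4) commutator_product_field_left[OF commutator(1,2), symmetric]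
      by (auto intro: lie_generated.commutator)
  qed (auto simp: product_field_add_left product_field_scale_left
      intro: lie_generated.add lie_generated.scale)
  then show ?thesis using assms(3,4) by blast
qed

text \<open>With the first factor arbitrary, the same argument runs over the second factor.\<close>

lemma product_field_in_L:
  assumes "algebraic_hamiltonian_density_property X \<omega>X"
    and "algebraic_hamiltonian_density_property Y \<omega>Y"
    and "hamiltonian X \<omega>X a U" "hamiltonian Y \<omega>Y b W"
  shows "product_field a U b W \<in> L"
proof -
  have "\<forall>a U. hamiltonian X \<omega>X a U \<longrightarrow> product_field a U b W \<in> L"
    using assms(2,4)
  proof (induction rule: Y.density_induct)
    case (gen b W)
    then show ?case using product_field_complete_right[OF assms(1)] by blast
  next
    case (commutator b W b' W')
    have "product_field (\<lambda>_. 1) (\<lambda>_. 0) b W \<in> L"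
      using commutator(3) X.hamiltonian_const by blast
    then show ?case
      using commutator(4) commutator_product_field_right[OF commutator(1,2), symmetric]
      by (auto intro: lie_generated.commutator)
  qed (auto simp: product_field_add_right product_field_scale_right
      intro: lie_generated.add lie_generated.scale)
  then show ?thesis using assms(3) by blast
qed

lemma hamiltonian_tensor:
  assumes "algebraic_hamiltonian_density_property X \<omega>X"
    and "algebraic_hamiltonian_density_property Y \<omega>Y"
    and "\<forall>(a, b)\<in>set ps. (\<exists>U. hamiltonian X \<omega>X a U) \<and> (\<exists>W. hamiltonian Y \<omega>Y b W)"
  shows "\<exists>V\<in>L. hamiltonian Z \<omega>Z (\<lambda>z. tensor ps (proj_X z) (proj_Y z)) V"
  using assms(3)
proof (induction ps)
  case Nil
  then show ?case using Z.hamiltonian_const lie_generated.zero by auto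
next
  case (Cons p ps)
  then obtain a b U W where p: "p = (a, b)" "hamiltonian X \<omega>X a U" "hamiltonian Y \<omega>Y b W"
    by (auto split: prod.splits)
  obtain V where V: "V \<in> L" "hamiltonian Z \<omega>Z (\<lambda>z. tensor ps (proj_X z) (proj_Y z)) V"
    using Cons by auto
  have "(\<lambda>z. product_field a U b W z + V z) \<in> L"
    using product_field_in_L[OF assms(1,2) p(2,3)] V(1) by (rule lie_generated.add)
  then show ?case
    using Z.hamiltonian_add[OF hamiltonian_product_field[OF p(2,3)] V(2)] p(1) by auto
qed

text \<open>A Hamiltonian field of a slice of \<open>f\<close> is the corresponding component of the Hamiltonian field of \<open>f\<close>.\<close>

lemma hamiltonian_slice_left:
  assumes "hamiltonian Z \<omega>Z f V" "y \<in> Y"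
  shows "\<exists>U. hamiltonian X \<omega>X (\<lambda>x. f (pair x y)) U"
proof -
  obtain F T where F: "poly_fun F" "\<And>q. q \<in> Z \<Longrightarrow> f q = F q" "tangent_field Z T"
    "\<And>p w. p \<in> Z \<Longrightarrow> w \<in> tangent_space Z p \<Longrightarrow> \<omega>Z p (T p) w = D F p w"
    using assms(1) by (rule hamiltonianE) blast
  let ?U = "\<lambda>x. proj_X (T (pair x y))"
  have "hamiltonian X \<omega>X (\<lambda>x. f (pair x y)) (restrict_field X ?U)"
  proof (rule hamiltonianI[of "\<lambda>x. F (pair x y)" _ _ ?U])
    show "tangent_field X ?U"
      unfolding tangent_field_def poly_field_def
    proof safe
      show "poly_fun (\<lambda>x. proj_X (T (pair x y)) $ i)" for i
        using F(3) poly_fun_pair_left[of "\<lambda>z. T z $ Inl i"]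
        by (simp add: tangent_field_def poly_field_def)
      show "proj_X (T (pair x y)) \<in> tangent_space X x" if "x \<in> X" for x
        using F(3) that assms(2) tangent_space_product[of "pair x y" X Y "T (pair x y)"]
        by (simp add: tangent_field_def)
    qed
    show "\<omega>X x (?U x) u = D (\<lambda>x. F (pair x y)) x u" if "x \<in> X" "u \<in> tangent_space X x" for x u
    proof -
      have z: "pair x y \<in> Z" "pair u 0 \<in> tangent_space Z (pair x y)"
        using that assms(2) by (simp_all add: tangent_space_product tangent_zero)
      then have "\<omega>Z (pair x y) (T (pair x y)) (pair u 0) = \<omega>X x (?U x) u"
        using F(3) product_form_left[of "pair x y" "T (pair x y)" u] by (simp add: tangent_field_def)
      then show ?thesis using F(1,4) z by (simp add: D_pair_left)
    qed
  qed (use F(1,2) assms(2) in \<open>auto simp: poly_fun_pair_left restrict_field_def\<close>)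
  then show ?thesis by blast
qed

lemma hamiltonian_slice_right:
  assumes "hamiltonian Z \<omega>Z f V" "x \<in> X"
  shows "\<exists>W. hamiltonian Y \<omega>Y (\<lambda>y. f (pair x y)) W"
proof -
  obtain F T where F: "poly_fun F" "\<And>q. q \<in> Z \<Longrightarrow> f q = F q" "tangent_field Z T"
    "\<And>p w. p \<in> Z \<Longrightarrow> w \<in> tangent_space Z p \<Longrightarrow> \<omega>Z p (T p) w = D F p w"
    using assms(1) by (rule hamiltonianE) blast
  let ?W = "\<lambda>y. proj_Y (T (pair x y))"
  have "hamiltonian Y \<omega>Y (\<lambda>y. f (pair x y)) (restrict_field Y ?W)"
  proof (rule hamiltonianI[of "\<lambda>y. F (pair x y)" _ _ ?W])
    show "tangent_field Y ?W"
      unfolding tangent_field_def poly_field_def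
    proof safe
      show "poly_fun (\<lambda>y. proj_Y (T (pair x y)) $ i)" for i
        using F(3) poly_fun_pair_right[of "\<lambda>z. T z $ Inr i"]
        by (simp add: tangent_field_def poly_field_def)
      show "proj_Y (T (pair x y)) \<in> tangent_space Y y" if "y \<in> Y" for y
        using F(3) that assms(2) tangent_space_product[of "pair x y" X Y "T (pair x y)"]
        by (simp add: tangent_field_def)
    qed
    show "\<omega>Y y (?W y) u = D (\<lambda>y. F (pair x y)) y u" if "y \<in> Y" "u \<in> tangent_space Y y" for y u
    proof -
      have z: "pair x y \<in> Z" "pair 0 u \<in> tangent_space Z (pair x y)"
        using that assms(2) by (simp_all add: tangent_space_product tangent_zero)
      then have "\<omega>Z (pair x y) (T (pair x y)) (pair 0 u) = \<omega>Y y (?W y) u"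
        using F(3) product_form_right[of "pair x y" "T (pair x y)" u] by (simp add: tangent_field_def)
      then show ?thesis using F(1,4) z by (simp add: D_pair_right)
    qed
  qed (use F(1,2) assms(2) in \<open>auto simp: poly_fun_pair_right restrict_field_def\<close>)
  then show ?thesis by blast
qed

lemma HVF_alg_subset_L:
  assumes "algebraic_hamiltonian_density_property X \<omega>X"
    and "algebraic_hamiltonian_density_property Y \<omega>Y"
  shows "HVF_alg Z \<omega>Z \<subseteq> L"
proof
  fix V assume "V \<in> HVF_alg Z \<omega>Z"
  then obtain f where f: "hamiltonian Z \<omega>Z f V" by (auto simp: HVF_alg_iff)
  then obtain F where F: "poly_fun F" "\<And>q. q \<in> Z \<Longrightarrow> f q = F q"
    by (rule hamiltonianE) blast
  obtain ps where ps: "\<And>x y. F (pair x y) = tensor ps x y"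
    using poly_fun_tensor[OF F(1)] by blast
  let ?S = "\<lambda>a. \<exists>U. hamiltonian X \<omega>X a U" and ?T = "\<lambda>b. \<exists>W. hamiltonian Y \<omega>Y b W"
  have "\<exists>qs. (\<forall>(a, b)\<in>set qs. ?S a \<and> ?T b) \<and> (\<forall>x\<in>X. \<forall>y\<in>Y. f (pair x y) = tensor qs x y)"
  proof (rule tensor_both_factors)
    show "function_space ?S"
      unfolding function_space_def using X.hamiltonian_add X.hamiltonian_scale by blast
    show "function_space ?T"
      unfolding function_space_def using Y.hamiltonian_add Y.hamiltonian_scale by blast
  qed (use ps F(2) hamiltonian_slice_left[OF f] hamiltonian_slice_right[OF f] in auto)
  then obtain qs where qs: "\<forall>(a, b)\<in>set qs. ?S a \<and> ?T b"
    "\<forall>x\<in>X. \<forall>y\<in>Y. f (pair x y) = tensor qs x y" by blast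
  obtain W where W: "W \<in> L" "hamiltonian Z \<omega>Z (\<lambda>z. tensor qs (proj_X z) (proj_Y z)) W"
    using hamiltonian_tensor[OF assms qs(1)] by blast
  have "hamiltonian Z \<omega>Z f W"
  proof (rule hamiltonian_cong[OF W(2)])
    fix z assume "z \<in> Z"
    then show "tensor qs (proj_X z) (proj_Y z) = f z"
      using qs(2)[rule_format, of "proj_X z" "proj_Y z"] in_productD[of z X Y] by simp
  qed
  then have "V = W" using f Z.hamiltonian_unique by blast
  then show "V \<in> L" using W(1) by simp
qed

end


theorem theorem2p1:
  fixes X :: "(complex ^ 'n) set" and Y :: "(complex ^ 'm) set"
    and \<omega>X :: "complex ^ 'n \<Rightarrow> complex ^ 'n \<Rightarrow> complex ^ 'n \<Rightarrow> complex"
    and \<omega>Y :: "complex ^ 'm \<Rightarrow> complex ^ 'm \<Rightarrow> complex ^ 'm \<Rightarrow> complex"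
  assumes "smooth_affine_variety X" and "algebraic_symplectic_form X \<omega>X"
    and "smooth_affine_variety Y" and "algebraic_symplectic_form Y \<omega>Y"
    and "algebraic_hamiltonian_density_property X \<omega>X"
    and "algebraic_hamiltonian_density_property Y \<omega>Y"
  shows "algebraic_hamiltonian_density_property (product_variety X Y) (product_form \<omega>X \<omega>Y)"
proof -
  obtain A where "symplectic_variety X \<omega>X A"
    using assms(1,2) by (rule symplectic_varietyI)
  moreover obtain B where "symplectic_variety Y \<omega>Y B"
    using assms(3,4) by (rule symplectic_varietyI)
  ultimately interpret symplectic_pair X \<omega>X A Y \<omega>Y B
    by (rule symplectic_pair.intro)
  have "L \<subseteq> HVF_alg Z \<omega>Z"
    by (rule Z.lie_generated_subset_HVF_alg) blast
  then show ?thesis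
    unfolding algebraic_hamiltonian_density_property_def
    using HVF_alg_subset_L[OF assms(5,6)] by blast
qed

end
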